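(* Let $G$ be a finite group and let $k$ be an algebraically closed field of characteristic $r>0$. Suppose $H \leq G$ is a subgroup such that $O_{r'}(H) = O^r(H)$, and let $\mathcal{L} = \operatorname{Ind}_H^G k$ be the permutation module of $G$ acting on the cosets of $H$. Let $V$ be a (finite-dimensional) $kG$-module with $V^H = 0$. Then $$\operatorname{H}^1(G,V) \cong \operatorname{Hom}_{G}(V^*, \mathcal{L}/k),$$ where $k$ is identified with the submodule $\mathcal{L}^G$ of $\mathcal{L}$.
   Context: For a finite group $H$ and a prime $r$, $O_{r'}(H)$ is the largest normal subgroup of $H$ of order not divisible by $r$, and $O^r(H)$ is the smallest normal subgroup of $H$ such that $H/O^r(H)$ is an $r$-group. $V^H$ denotes the $H$-fixed points of $V$ and $V^*$ the dual module; $\operatorname{Hom}_G$ means $\operatorname{Hom}_{kG}$. The submodule $\mathcal{L}^G$ of $G$-fixed points of $\mathcal{L}$ is isomorphic to the trivial module $k$. All modules are finite-dimensional. *)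

theory Defs
  imports "HOL-Algebra.Algebra"
begin

section \<open>Finite groups and fields\<close>

text \<open>
  \<open>core_prime_to r G\<close> is usually written \<open>O\<^sub>r'(G)\<close> and \<open>residual_subgroup r G\<close> is written
  \<open>O\<^sup>r(G)\<close>. ``Largest'' and ``smallest'' are with respect to inclusion; that these
  subgroups exist for finite \<open>G\<close> and prime \<open>r\<close> is proved below.
\<close>

definition core_prime_to :: "nat \<Rightarrow> ('g, 'x) monoid_scheme \<Rightarrow> 'g set"
  where "core_prime_to r G = (GREATEST N. N \<lhd> G \<and> \<not> r dvd card N)"

definition residual_subgroup :: "nat \<Rightarrow> ('g, 'x) monoid_scheme \<Rightarrow> 'g set"
  where "residual_subgroup r G = (LEAST N. N \<lhd> G \<and> (\<exists>n. order (G Mod N) = r ^ n))"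

definition ring_char :: "('a, 'y) ring_scheme \<Rightarrow> nat"
  where "ring_char R =
    (if \<exists>n::nat. n > 0 \<and> [n] \<cdot>\<^bsub>R\<^esub> \<one>\<^bsub>R\<^esub> = \<zero>\<^bsub>R\<^esub>
     then LEAST n::nat. n > 0 \<and> [n] \<cdot>\<^bsub>R\<^esub> \<one>\<^bsub>R\<^esub> = \<zero>\<^bsub>R\<^esub> else 0)"

section \<open>Linear algebra over a commutative ring\<close>

text \<open>
  The type of module records extends that of ring records, so it has fields
  \<^const>\<open>monoid.mult\<close> and \<^const>\<open>one\<close> which are meaningless for a mere module. They are left
  \<^const>\<open>undefined\<close> below. Functions out of a carrier are extensional, so that function spaces
  contain each function once.
\<close>

definition finite_dimensional :: "('a, 'y) ring_scheme \<Rightarrow> ('a, 'b, 'm) module_scheme \<Rightarrow> bool"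
  where "finite_dimensional K M \<longleftrightarrow>
    (\<exists>B. finite B \<and> B \<subseteq> carrier M \<and>
      (\<forall>x\<in>carrier M. \<exists>c\<in>B \<rightarrow> carrier K. x = (\<Oplus>\<^bsub>M\<^esub>b\<in>B. c b \<odot>\<^bsub>M\<^esub> b)))"

definition base_module :: "('a, 'y) ring_scheme \<Rightarrow> ('a, 'a) module"
  where "base_module K =
    \<lparr>carrier = carrier K, monoid.mult = undefined, one = undefined,
     ring.zero = \<zero>\<^bsub>K\<^esub>, ring.add = ring.add K, smult = monoid.mult K\<rparr>"

definition fun_module :: "'s set \<Rightarrow> ('a, 'b, 'm) module_scheme \<Rightarrow> ('a, 's \<Rightarrow> 'b) module"
  where "fun_module S M =
    \<lparr>carrier = S \<rightarrow>\<^sub>E carrier M, monoid.mult = undefined, one = undefined,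
     ring.zero = (\<lambda>s\<in>S. \<zero>\<^bsub>M\<^esub>),
     ring.add = (\<lambda>f g. \<lambda>s\<in>S. f s \<oplus>\<^bsub>M\<^esub> g s),
     smult = (\<lambda>a f. \<lambda>s\<in>S. a \<odot>\<^bsub>M\<^esub> f s)\<rparr>"

definition quotient_module :: "('a, 'b, 'm) module_scheme \<Rightarrow> 'b set \<Rightarrow> ('a, 'b set) module"
  where "quotient_module M N =
    \<lparr>carrier = a_rcosets\<^bsub>M\<^esub> N, monoid.mult = undefined, one = undefined,
     ring.zero = N, ring.add = set_add M,
     smult = (\<lambda>a C. \<Union>x\<in>C. N +>\<^bsub>M\<^esub> (a \<odot>\<^bsub>M\<^esub> x))\<rparr>"

definition linear_maps ::
    "('a, 'y) ring_scheme \<Rightarrow> ('a, 'b, 'm) module_scheme \<Rightarrow> ('a, 'c, 'n) module_scheme \<Rightarrow> ('b \<Rightarrow> 'c) set"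
  where "linear_maps K M N =
    {f \<in> carrier M \<rightarrow>\<^sub>E carrier N.
      (\<forall>x\<in>carrier M. \<forall>y\<in>carrier M. f (x \<oplus>\<^bsub>M\<^esub> y) = f x \<oplus>\<^bsub>N\<^esub> f y) \<and>
      (\<forall>a\<in>carrier K. \<forall>x\<in>carrier M. f (a \<odot>\<^bsub>M\<^esub> x) = a \<odot>\<^bsub>N\<^esub> f x)}"

definition isomorphic_modules ::
    "('a, 'y) ring_scheme \<Rightarrow> ('a, 'b, 'm) module_scheme \<Rightarrow> ('a, 'c, 'n) module_scheme \<Rightarrow> bool"
  where "isomorphic_modules K M N \<longleftrightarrow>
    (\<exists>f\<in>linear_maps K M N. bij_betw f (carrier M) (carrier N))"

section \<open>Modules for a group\<close>

text \<open>
  A module for the group ring \<open>KG\<close> is given as a \<open>K\<close>-module with a \<open>K\<close>-linear action of \<open>G\<close>.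
\<close>

record ('a, 'b, 'g) gmodule = "('a, 'b) module" +
  act :: "'g \<Rightarrow> 'b \<Rightarrow> 'b"

locale group_module = G: group G + V: module K V
  for G :: "('g, 'x) monoid_scheme"
    and K :: "('a, 'y) ring_scheme"
    and V :: "('a, 'b, 'g, 'z) gmodule_scheme" +
  assumes act_closed: "\<lbrakk>g \<in> carrier G; v \<in> carrier V\<rbrakk> \<Longrightarrow> act V g v \<in> carrier V"
    and act_add: "\<lbrakk>g \<in> carrier G; v \<in> carrier V; w \<in> carrier V\<rbrakk> \<Longrightarrow>
      act V g (v \<oplus>\<^bsub>V\<^esub> w) = act V g v \<oplus>\<^bsub>V\<^esub> act V g w"
    and act_smult: "\<lbrakk>g \<in> carrier G; a \<in> carrier K; v \<in> carrier V\<rbrakk> \<Longrightarrow>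
      act V g (a \<odot>\<^bsub>V\<^esub> v) = a \<odot>\<^bsub>V\<^esub> act V g v"
    and act_one: "v \<in> carrier V \<Longrightarrow> act V \<one>\<^bsub>G\<^esub> v = v"
    and act_mult: "\<lbrakk>g \<in> carrier G; h \<in> carrier G; v \<in> carrier V\<rbrakk> \<Longrightarrow>
      act V (g \<otimes>\<^bsub>G\<^esub> h) v = act V g (act V h v)"

definition fixed_points :: "'g set \<Rightarrow> ('a, 'b, 'g, 'z) gmodule_scheme \<Rightarrow> 'b set"
  where "fixed_points H V = {v \<in> carrier V. \<forall>h\<in>H. act V h v = v}"

definition with_act :: "('a, 'b, 'm) module_scheme \<Rightarrow> ('g \<Rightarrow> 'b \<Rightarrow> 'b) \<Rightarrow> ('a, 'b, 'g) gmodule"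
  where "with_act M \<alpha> =
    \<lparr>carrier = carrier M, monoid.mult = monoid.mult M, one = monoid.one M,
     ring.zero = ring.zero M, ring.add = ring.add M,
     smult = smult M, act = \<alpha>\<rparr>"

definition dual_gmodule ::
    "('g, 'x) monoid_scheme \<Rightarrow> ('a, 'y) ring_scheme \<Rightarrow> ('a, 'b, 'g, 'z) gmodule_scheme
      \<Rightarrow> ('a, 'b \<Rightarrow> 'a, 'g) gmodule"
  where "dual_gmodule G K V =
    with_act ((fun_module (carrier V) (base_module K))\<lparr>carrier := linear_maps K V (base_module K)\<rparr>)
      (\<lambda>g f. \<lambda>v\<in>carrier V. f (act V (inv\<^bsub>G\<^esub> g) v))"

text \<open>
  The permutation module on the left cosets of a subgroup \<open>H\<close> of finite index, as \<open>K\<close>-valued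
  functions on \<open>G/H\<close>; the action sends the indicator function of a coset \<open>C\<close> to that of \<open>g C\<close>.
\<close>

definition coset_gmodule ::
    "('g, 'x) monoid_scheme \<Rightarrow> ('a, 'y) ring_scheme \<Rightarrow> 'g set \<Rightarrow> ('a, 'g set \<Rightarrow> 'a, 'g) gmodule"
  where "coset_gmodule G K H =
    with_act (fun_module (lcosets\<^bsub>G\<^esub> H) (base_module K))
      (\<lambda>g \<phi>. \<lambda>C\<in>lcosets\<^bsub>G\<^esub> H. \<phi> (inv\<^bsub>G\<^esub> g <#\<^bsub>G\<^esub> C))"

definition quotient_gmodule ::
    "('a, 'b, 'g, 'z) gmodule_scheme \<Rightarrow> 'b set \<Rightarrow> ('a, 'b set, 'g) gmodule"
  where "quotient_gmodule V N =
    with_act (quotient_module V N) (\<lambda>g C. \<Union>x\<in>C. N +>\<^bsub>V\<^esub> act V g x)"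

definition Hom_module ::
    "('g, 'x) monoid_scheme \<Rightarrow> ('a, 'y) ring_scheme \<Rightarrow> ('a, 'b, 'g, 'z) gmodule_scheme
      \<Rightarrow> ('a, 'c, 'g, 'w) gmodule_scheme \<Rightarrow> ('a, 'b \<Rightarrow> 'c) module"
  where "Hom_module G K V W =
    (fun_module (carrier V) W)\<lparr>carrier :=
      {f \<in> linear_maps K V W. \<forall>g\<in>carrier G. \<forall>v\<in>carrier V. f (act V g v) = act W g (f v)}\<rparr>"

section \<open>First cohomology\<close>

definition cocycles ::
    "('g, 'x) monoid_scheme \<Rightarrow> ('a, 'b, 'g, 'z) gmodule_scheme \<Rightarrow> ('g \<Rightarrow> 'b) set"
  where "cocycles G V =
    {\<delta> \<in> carrier G \<rightarrow>\<^sub>E carrier V.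
      \<forall>g\<in>carrier G. \<forall>h\<in>carrier G. \<delta> (g \<otimes>\<^bsub>G\<^esub> h) = \<delta> g \<oplus>\<^bsub>V\<^esub> act V g (\<delta> h)}"

definition coboundaries ::
    "('g, 'x) monoid_scheme \<Rightarrow> ('a, 'b, 'g, 'z) gmodule_scheme \<Rightarrow> ('g \<Rightarrow> 'b) set"
  where "coboundaries G V = {\<lambda>g\<in>carrier G. act V g v \<ominus>\<^bsub>V\<^esub> v | v. v \<in> carrier V}"

definition H1 ::
    "('g, 'x) monoid_scheme \<Rightarrow> ('a, 'b, 'g, 'z) gmodule_scheme \<Rightarrow> ('a, ('g \<Rightarrow> 'b) set) module"
  where "H1 G V =
    quotient_module ((fun_module (carrier G) V)\<lparr>carrier := cocycles G V\<rparr>) (coboundaries G V)"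

section \<open>The definitions have the intended properties\<close>

subsection \<open>Existence of the two characteristic subgroups\<close>

lemma (in group) card_set_mult_eq:
  assumes fin: "finite (carrier G)" and M: "M \<lhd> G" and N: "N \<lhd> G"
  shows "card (M <#> N) * card (M \<inter> N) = card M * card N"
proof -
  interpret S: second_isomorphism_grp M G N
    using M N by (simp add: second_isomorphism_grp_def second_isomorphism_grp_axioms_def normal_imp_subgroup)
  let ?P = "M <#> N"
  have sub: "subgroup M G" "subgroup N G" "subgroup ?P G"
    using M N S.normal_set_mult_subgroup normal_imp_subgroup by auto
  interpret P: group "G\<lparr>carrier := ?P\<rparr>" using sub(3) subgroup_imp_group by blast
  interpret Ng: group "G\<lparr>carrier := N\<rparr>" using sub(2) subgroup_imp_group by blast
  have "card (carrier ((G\<lparr>carrier := N\<rparr>) Mod (M \<inter> N))) = card (carrier ((G\<lparr>carrier := ?P\<rparr>) Mod M))"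
    using S.normal_intersection_quotient_isom iso_same_card is_isoI by blast
  then have eq: "card (rcosets\<^bsub>G\<lparr>carrier := N\<rparr>\<^esub> (M \<inter> N)) = card (rcosets\<^bsub>G\<lparr>carrier := ?P\<rparr>\<^esub> M)"
    by (simp add: FactGroup_def)
  have "subgroup M (G\<lparr>carrier := ?P\<rparr>)"
    using sub S.H_contained_in_set_mult subgroup_incl by blast
  then have 1: "card (rcosets\<^bsub>G\<lparr>carrier := ?P\<rparr>\<^esub> M) * card M = card ?P"
    using P.lagrange by (simp add: order_def)
  have "subgroup (M \<inter> N) (G\<lparr>carrier := N\<rparr>)"
    using sub subgroup_incl subgroups_Inter_pair by (metis inf.cobounded2)
  then have 2: "card (rcosets\<^bsub>G\<lparr>carrier := N\<rparr>\<^esub> (M \<inter> N)) * card (M \<inter> N) = card N"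
    using Ng.lagrange by (simp add: order_def)
  show ?thesis using 1 2 eq by (metis mult.assoc mult.commute)
qed

lemma (in group) card_pos:
  assumes "finite (carrier G)" "subgroup M G" shows "card M > 0"
  using assms by (metis card_gt_0_iff finite_subset subgroup.one_closed subgroup.subset empty_iff)

theorem core_prime_to:
  fixes G :: "('g, 'x) monoid_scheme" (structure)
  assumes "group G" and fin: "finite (carrier G)" and r: "Factorial_Ring.prime r"
  shows "core_prime_to r G \<lhd> G" and "\<not> r dvd card (core_prime_to r G)"
    and "\<And>N. \<lbrakk>N \<lhd> G; \<not> r dvd card N\<rbrakk> \<Longrightarrow> N \<subseteq> core_prime_to r G"
proof -
  interpret group G by fact
  let ?P = "\<lambda>N. N \<lhd> G \<and> \<not> r dvd card N"
  have sub: "M \<subseteq> carrier G" if "M \<lhd> G" for M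
    using that normal_imp_subgroup subgroup.subset by blast
  have "?P {\<one>}" using r one_is_normal by (simp add: prime_nat_iff)
  moreover have "finite {N. ?P N}"
    by (rule finite_subset[of _ "Pow (carrier G)"]) (use fin sub in auto)
  ultimately obtain Y where Y: "?P Y" and Ymax: "\<And>N. ?P N \<Longrightarrow> Y \<subseteq> N \<Longrightarrow> Y = N"
    using finite_has_maximal[of "{N. ?P N}"] by blast
  have max: "N \<subseteq> Y" if N: "?P N" for N
  proof -
    interpret S: second_isomorphism_grp Y G N
      using N Y by (simp add: second_isomorphism_grp_def second_isomorphism_grp_axioms_def normal_imp_subgroup)
    have "\<not> r dvd card (Y <#> N)"
      using card_set_mult_eq[OF fin, of Y N] N Y r
      by (metis dvd_mult2 prime_dvd_mult_iff)
    then have "Y = Y <#> N"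
      using Ymax normal_subgroup_set_mult_closed N Y S.H_contained_in_set_mult by blast
    then show ?thesis using S.S_contained_in_set_mult by simp
  qed
  have "core_prime_to r G = Y"
    unfolding core_prime_to_def by (rule Greatest_equality) (use Y max in auto)
  with Y max show "core_prime_to r G \<lhd> G" "\<not> r dvd card (core_prime_to r G)"
    "\<And>N. \<lbrakk>N \<lhd> G; \<not> r dvd card N\<rbrakk> \<Longrightarrow> N \<subseteq> core_prime_to r G" by auto
qed

theorem residual_subgroup:
  fixes G :: "('g, 'x) monoid_scheme" (structure)
  assumes "group G" and fin: "finite (carrier G)" and r: "Factorial_Ring.prime r"
  shows "residual_subgroup r G \<lhd> G" and "\<exists>n. order (G Mod residual_subgroup r G) = r ^ n"
    and "\<And>N n. \<lbrakk>N \<lhd> G; order (G Mod N) = r ^ n\<rbrakk> \<Longrightarrow> residual_subgroup r G \<subseteq> N"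
proof -
  interpret group G by fact
  let ?P = "\<lambda>N. N \<lhd> G \<and> (\<exists>n. order (G Mod N) = r ^ n)"
  have sub: "M \<subseteq> carrier G" if "M \<lhd> G" for M
    using that normal_imp_subgroup subgroup.subset by blast
  have idx: "order (G Mod N) * card N = order G" if "N \<lhd> G" for N
    using lagrange[OF normal_imp_subgroup[OF that]] by (simp add: FactGroup_def order_def)
  have oG: "order G > 0" using fin order_gt_0_iff_finite by blast
  have Gn: "carrier G \<lhd> G" by (simp add: normal_inv_iff subgroup_self)
  have "order (G Mod carrier G) * order G = order G" using idx[OF Gn] by (simp add: order_def)
  then have "order (G Mod carrier G) = r ^ 0" using oG by simp
  then have "?P (carrier G)" using Gn by blast
  moreover have "finite {N. ?P N}"
    by (rule finite_subset[of _ "Pow (carrier G)"]) (use fin sub in auto)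
  ultimately obtain Y where Y: "?P Y" and Ymin: "\<And>N. ?P N \<Longrightarrow> N \<subseteq> Y \<Longrightarrow> Y = N"
    using finite_has_minimal[of "{N. ?P N}"] by blast
  have min: "Y \<subseteq> N" if N: "?P N" for N
  proof -
    let ?I = "Y \<inter> N"
    have I: "?I \<lhd> G" using Y N normal_subgroup_intersect by blast
    have YN: "Y <#> N \<lhd> G" using normal_subgroup_set_mult_closed N Y by blast
    obtain a b where ab: "order (G Mod Y) = r ^ a" "order (G Mod N) = r ^ b" using Y N by blast
    define i where "i = order (G Mod ?I)"
    have pos: "card ?I > 0" "card Y > 0" "card N > 0" "card (Y <#> N) > 0"
      using card_pos fin normal_imp_subgroup I Y N YN by blast+
    have "i * card ?I * (order (G Mod (Y <#> N)) * card (Y <#> N))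
        = (order (G Mod Y) * card Y) * (order (G Mod N) * card N)"
      using idx I Y N YN by (simp add: i_def)
    then have "i * order (G Mod (Y <#> N)) * (card (Y <#> N) * card ?I) = r ^ a * r ^ b * (card Y * card N)"
      by (simp add: ab algebra_simps)
    then have "i * order (G Mod (Y <#> N)) = r ^ (a + b)"
      using card_set_mult_eq[OF fin, of Y N] Y N pos by (simp add: power_add)
    then have "i dvd r ^ (a + b)" by (metis dvd_triv_left)
    then obtain n where "i = r ^ n" using r divides_primepow_nat by blast
    then have "order (G Mod ?I) = r ^ n" by (simp add: i_def)
    then have "Y = ?I" using I by (intro Ymin) auto
    then show ?thesis by blast
  qed
  have "residual_subgroup r G = Y"
    unfolding residual_subgroup_def by (rule Least_equality) (use Y min in auto)
  with Y min show "residual_subgroup r G \<lhd> G" "\<exists>n. order (G Mod residual_subgroup r G) = r ^ n"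
    "\<And>N n. \<lbrakk>N \<lhd> G; order (G Mod N) = r ^ n\<rbrakk> \<Longrightarrow> residual_subgroup r G \<subseteq> N" by auto
qed
subsection \<open>The constructions are modules\<close>

lemma module_base_module:
  assumes "cring K" shows "module K (base_module K)"
proof -
  interpret K: cring K by fact
  show ?thesis
    by (rule moduleI; (rule abelian_groupI)?)
      (auto simp: base_module_def K.is_cring K.a_ac K.l_distr K.r_distr K.m_assoc
        intro: K.add.l_inv_ex)
qed

lemma module_fun_module:
  assumes "module K M" shows "module K (fun_module S M)"
proof -
  interpret M: module K M by fact
  show ?thesis
  proof (rule moduleI; (rule abelian_groupI)?)
    fix f assume f: "f \<in> carrier (fun_module S M)"
    then have "f s \<in> carrier M" if "s \<in> S" for s
      using that by (auto simp: fun_module_def)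
    then show "\<exists>g\<in>carrier (fun_module S M). g \<oplus>\<^bsub>fun_module S M\<^esub> f = \<zero>\<^bsub>fun_module S M\<^esub>"
      by (intro bexI[of _ "\<lambda>s\<in>S. \<ominus>\<^bsub>M\<^esub> f s"])
        (auto simp: fun_module_def M.l_neg intro!: restrict_ext)
  qed (force simp: fun_module_def M.R.is_cring PiE_iff extensional_def fun_eq_iff M.a_ac
      M.smult_l_distr M.smult_r_distr M.smult_assoc1)+
qed

lemma submodule_linear_maps:
  assumes "module K M" and "module K N"
  shows "submodule (linear_maps K M N) K (fun_module (carrier M) N)"
proof -
  interpret M: module K M by fact
  interpret N: module K N by fact
  let ?F = "fun_module (carrier M) N"
  interpret F: module K ?F by (rule module_fun_module) fact
  show ?thesis
  proof (rule F.submoduleI)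
    fix f assume f: "f \<in> linear_maps K M N"
    then have fc: "f x \<in> carrier N" if "x \<in> carrier M" for x
      using that by (auto simp: linear_maps_def)
    have "\<ominus>\<^bsub>?F\<^esub> f = (\<lambda>x\<in>carrier M. \<ominus>\<^bsub>N\<^esub> f x)"
      using f fc by (intro F.minus_equality)
        (auto simp: fun_module_def linear_maps_def N.l_neg intro!: restrict_ext)
    then show "\<ominus>\<^bsub>?F\<^esub> f \<in> linear_maps K M N"
      using f fc by (auto simp: linear_maps_def N.minus_add N.smult_r_minus)
  next
    fix f g assume "f \<in> linear_maps K M N" "g \<in> linear_maps K M N"
    moreover from this have "f x \<in> carrier N" "g x \<in> carrier N" if "x \<in> carrier M" for x
      using that by (auto simp: linear_maps_def)
    ultimately show "f \<oplus>\<^bsub>?F\<^esub> g \<in> linear_maps K M N"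
      by (simp add: linear_maps_def fun_module_def N.a_ac N.smult_r_distr)
  next
    fix a f assume "a \<in> carrier K" "f \<in> linear_maps K M N"
    moreover from this have "f x \<in> carrier N" if "x \<in> carrier M" for x
      using that by (auto simp: linear_maps_def)
    ultimately show "a \<odot>\<^bsub>?F\<^esub> f \<in> linear_maps K M N"
      by (simp add: linear_maps_def fun_module_def N.smult_r_distr N.smult_assoc1[symmetric] M.R.m_comm)
  qed (auto simp: linear_maps_def fun_module_def)
qed

lemma coset_in_quotient:
  "C \<in> carrier (quotient_module M N) \<longleftrightarrow> (\<exists>x\<in>carrier M. C = N +>\<^bsub>M\<^esub> x)"
  by (auto simp: quotient_module_def A_RCOSETS_def RCOSETS_def a_r_coset_def)

lemma Union_cosets:
  assumes "abelian_subgroup N M" and x: "x \<in> carrier M"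
    and f: "\<And>x. x \<in> carrier M \<Longrightarrow> f x \<in> carrier M"
    and add: "\<And>x y. \<lbrakk>x \<in> carrier M; y \<in> carrier M\<rbrakk> \<Longrightarrow> f (x \<oplus>\<^bsub>M\<^esub> y) = f x \<oplus>\<^bsub>M\<^esub> f y"
    and N: "\<And>n. n \<in> N \<Longrightarrow> f n \<in> N"
  shows "(\<Union>z\<in>N +>\<^bsub>M\<^esub> x. N +>\<^bsub>M\<^esub> f z) = N +>\<^bsub>M\<^esub> f x"
proof -
  interpret A: abelian_subgroup N M by fact
  have "N +>\<^bsub>M\<^esub> f z = N +>\<^bsub>M\<^esub> f x" if "z \<in> N +>\<^bsub>M\<^esub> x" for z
  proof -
    from that obtain n where n: "n \<in> N" "z = n \<oplus>\<^bsub>M\<^esub> x" by (auto simp: a_r_coset_def r_coset_def)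
    then have "f z = f n \<oplus>\<^bsub>M\<^esub> f x" using x add A.a_subset by auto
    then show ?thesis
      using N n x f A.a_rcos_const A.a_subset A.a_coset_add_assoc
      by (metis A.a_Hcarr)
  qed
  moreover have "x \<in> N +>\<^bsub>M\<^esub> x" using x by (simp add: A.a_rcos_self)
  ultimately show ?thesis by blast
qed

lemma submodule_abelian_subgroup:
  assumes "module K M" and "submodule N K M"
  shows "abelian_subgroup N M"
  using assms by (intro abelian_subgroupI3 additive_subgroup.intro)
    (auto simp: submodule_def module_def)

lemma smult_quotient_module:
  assumes "module K M" and "submodule N K M" and "a \<in> carrier K" and "x \<in> carrier M"
  shows "a \<odot>\<^bsub>quotient_module M N\<^esub> (N +>\<^bsub>M\<^esub> x) = N +>\<^bsub>M\<^esub> (a \<odot>\<^bsub>M\<^esub> x)"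
proof -
  interpret M: module K M by fact
  interpret N: submodule N K M by fact
  show ?thesis
    using assms by (simp add: quotient_module_def Union_cosets submodule_abelian_subgroup M.smult_r_distr)
qed

lemma module_quotient_module:
  assumes "module K M" and "submodule N K M"
  shows "module K (quotient_module M N)"
proof -
  interpret M: module K M by fact
  interpret N: submodule N K M by fact
  interpret A: abelian_subgroup N M by (rule submodule_abelian_subgroup) fact+
  let ?Q = "quotient_module M N"
  have S: "(N +>\<^bsub>M\<^esub> x) \<oplus>\<^bsub>?Q\<^esub> (N +>\<^bsub>M\<^esub> y) = N +>\<^bsub>M\<^esub> (x \<oplus>\<^bsub>M\<^esub> y)"
    if "x \<in> carrier M" "y \<in> carrier M" for x y
    using that A.a_rcos_sum by (simp add: quotient_module_def)
  have Z: "\<zero>\<^bsub>?Q\<^esub> = N +>\<^bsub>M\<^esub> \<zero>\<^bsub>M\<^esub>"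
    using A.a_subset by (simp add: quotient_module_def)
  note T = smult_quotient_module[OF assms]
  have C: "N +>\<^bsub>M\<^esub> x \<in> carrier ?Q" if "x \<in> carrier M" for x
    using that coset_in_quotient by blast
  show ?thesis
  proof (rule moduleI; (rule abelian_groupI)?)
    fix D assume "D \<in> carrier ?Q"
    then obtain x where x: "x \<in> carrier M" "D = N +>\<^bsub>M\<^esub> x" by (auto simp: coset_in_quotient)
    then show "\<exists>D2\<in>carrier ?Q. D2 \<oplus>\<^bsub>?Q\<^esub> D = \<zero>\<^bsub>?Q\<^esub>"
      by (intro bexI[of _ "N +>\<^bsub>M\<^esub> (\<ominus>\<^bsub>M\<^esub> x)"]) (simp_all add: S Z C M.l_neg)
  qed (auto simp: coset_in_quotient S T Z M.R.is_cring M.a_ac M.smult_l_distr M.smult_r_distr M.smult_assoc1)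
qed

lemma submodule_module: "module K M \<Longrightarrow> submodule N K M \<Longrightarrow> module K (M\<lparr>carrier := N\<rparr>)"
  by (rule submodule.submodule_is_module)

lemma module_with_act [simp]: "module K (with_act M \<alpha>) \<longleftrightarrow> module K M"
proof -
  have "abelian_group (with_act M \<alpha>) \<longleftrightarrow> abelian_group M"
    by (simp add: with_act_def abelian_group_def abelian_monoid_def abelian_group_axioms_def
        comm_group_def comm_monoid_def comm_monoid_axioms_def group_def group_axioms_def monoid_def Units_def)
  then show ?thesis
    by (simp add: module_def module_axioms_def) (simp add: with_act_def)
qed

theorem group_module_dual:
  assumes "group_module G K V"
  shows "group_module G K (dual_gmodule G K V)"
proof -
  interpret group_module G K V by fact
  have "cring K" by (rule V.R.is_cring)
  then have "module K (dual_gmodule G K V)"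
    by (simp add: dual_gmodule_def submodule_module module_fun_module module_base_module
        submodule_linear_maps V.module_axioms)
  then show ?thesis
    by (intro group_module.intro group_module_axioms.intro)
      (auto simp: G.group_axioms dual_gmodule_def with_act_def fun_module_def linear_maps_def base_module_def
        act_closed act_add act_smult act_one act_mult G.inv_mult_group extensional_def fun_eq_iff
        intro!: restrict_ext)
qed

theorem group_module_coset:
  assumes "group G" and "cring K" and "subgroup H G"
  shows "group_module G K (coset_gmodule G K H)"
proof -
  interpret G: group G by fact
  interpret K: cring K by fact
  interpret H: subgroup H G by fact
  have C: "x <#\<^bsub>G\<^esub> C \<in> lcosets\<^bsub>G\<^esub> H" if "x \<in> carrier G" "C \<in> lcosets\<^bsub>G\<^esub> H" for x C
    using that G.lcos_m_assoc[OF H.subset] unfolding LCOSETS_def by fastforce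
  have D: "C \<subseteq> carrier G" if "C \<in> lcosets\<^bsub>G\<^esub> H" for C
    using that G.l_coset_subset_G[OF H.subset] unfolding LCOSETS_def by auto
  have "module K (coset_gmodule G K H)"
    by (simp add: coset_gmodule_def module_fun_module module_base_module assms)
  then show ?thesis
    by (intro group_module.intro group_module_axioms.intro)
      (auto simp: G.group_axioms coset_gmodule_def with_act_def fun_module_def base_module_def
        C G.inv_mult_group extensional_def fun_eq_iff G.lcos_m_assoc D G.lcos_mult_one intro!: restrict_ext)
qed

theorem group_module_quotient:
  assumes "group_module G K V" and N: "submodule N K V"
    and inv: "\<And>g x. g \<in> carrier G \<Longrightarrow> x \<in> N \<Longrightarrow> act V g x \<in> N"
  shows "group_module G K (quotient_gmodule V N)"
proof -
  interpret group_module G K V by fact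
  interpret A: abelian_subgroup N V by (rule submodule_abelian_subgroup) (fact V.module_axioms N)+
  let ?Q = "quotient_module V N"
  note mod = V.module_axioms N
  have act: "act (quotient_gmodule V N) g (N +>\<^bsub>V\<^esub> x) = N +>\<^bsub>V\<^esub> act V g x"
    if "g \<in> carrier G" "x \<in> carrier V" for g x
    using that by (simp add: quotient_gmodule_def with_act_def Union_cosets[OF A.abelian_subgroup_axioms] act_closed act_add inv)
  have S: "(N +>\<^bsub>V\<^esub> x) \<oplus>\<^bsub>?Q\<^esub> (N +>\<^bsub>V\<^esub> y) = N +>\<^bsub>V\<^esub> (x \<oplus>\<^bsub>V\<^esub> y)"
    if "x \<in> carrier V" "y \<in> carrier V" for x y
    using that A.a_rcos_sum by (simp add: quotient_module_def)
  have E: "carrier (quotient_gmodule V N) = carrier ?Q" "add (quotient_gmodule V N) = add ?Q"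
    "smult (quotient_gmodule V N) = smult ?Q"
    by (simp_all add: quotient_gmodule_def with_act_def)
  have "module K (quotient_gmodule V N)"
    by (simp add: quotient_gmodule_def module_quotient_module mod)
  then show ?thesis
    by (intro group_module.intro group_module_axioms.intro)
      (auto simp: G.group_axioms E coset_in_quotient act S smult_quotient_module[OF mod]
       act_closed act_add act_smult act_one act_mult)
qed

theorem fixed_points_coset_gmodule:
  assumes "group G" and "subgroup H G"
  shows "fixed_points (carrier G) (coset_gmodule G K H) = {\<lambda>C\<in>lcosets\<^bsub>G\<^esub> H. a | a. a \<in> carrier K}"
proof -
  interpret G: group G by fact
  interpret H: subgroup H G by fact
  have C: "x <#\<^bsub>G\<^esub> H \<in> lcosets\<^bsub>G\<^esub> H" if "x \<in> carrier G" for x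
    using that by (auto simp: LCOSETS_def)
  have C': "x <#\<^bsub>G\<^esub> C \<in> lcosets\<^bsub>G\<^esub> H" if "x \<in> carrier G" "C \<in> lcosets\<^bsub>G\<^esub> H" for x C
    using that G.lcos_m_assoc[OF H.subset] unfolding LCOSETS_def by fastforce
  have "\<phi> = (\<lambda>C\<in>lcosets\<^bsub>G\<^esub> H. \<phi> H)" "\<phi> H \<in> carrier K"
    if \<phi>: "\<phi> \<in> fixed_points (carrier G) (coset_gmodule G K H)" for \<phi>
  proof -
    have "\<phi> (g <#\<^bsub>G\<^esub> H) = \<phi> H" if g: "g \<in> carrier G" for g
    proof -
      have "\<phi> (g <#\<^bsub>G\<^esub> H) = (\<lambda>C\<in>lcosets\<^bsub>G\<^esub> H. \<phi> (inv\<^bsub>G\<^esub> g <#\<^bsub>G\<^esub> C)) (g <#\<^bsub>G\<^esub> H)"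
        using \<phi> g by (simp add: fixed_points_def coset_gmodule_def with_act_def)
      also have "\<dots> = \<phi> (inv\<^bsub>G\<^esub> g <#\<^bsub>G\<^esub> (g <#\<^bsub>G\<^esub> H))" using C g by simp
      also have "\<dots> = \<phi> H" using g by (simp add: G.lcos_m_assoc H.subset G.lcos_mult_one)
      finally show ?thesis .
    qed
    moreover have "\<phi> \<in> lcosets\<^bsub>G\<^esub> H \<rightarrow>\<^sub>E carrier K"
      using \<phi> by (simp add: fixed_points_def coset_gmodule_def with_act_def fun_module_def base_module_def)
    moreover have "H \<in> lcosets\<^bsub>G\<^esub> H"
      using C[OF G.one_closed] by (simp add: G.lcos_mult_one H.subset)
    ultimately show "\<phi> = (\<lambda>C\<in>lcosets\<^bsub>G\<^esub> H. \<phi> H)" "\<phi> H \<in> carrier K"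
      by (auto simp: fun_eq_iff LCOSETS_def PiE_iff extensional_def)
  qed
  moreover have "(\<lambda>C\<in>lcosets\<^bsub>G\<^esub> H. a) \<in> fixed_points (carrier G) (coset_gmodule G K H)"
    if "a \<in> carrier K" for a
    using that C' by (auto simp: fixed_points_def coset_gmodule_def with_act_def fun_module_def base_module_def fun_eq_iff)
  ultimately show ?thesis by blast
qed

lemma minus_eq_smult:
  assumes "module K M" and "x \<in> carrier M"
  shows "\<ominus>\<^bsub>M\<^esub> x = (\<ominus>\<^bsub>K\<^esub> \<one>\<^bsub>K\<^esub>) \<odot>\<^bsub>M\<^esub> x"
proof -
  interpret M: module K M by fact
  show ?thesis using assms by (simp add: M.smult_l_minus)
qed

theorem submodule_fixed_points:
  assumes "group_module G K V" and "H \<subseteq> carrier G"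
  shows "submodule (fixed_points H V) K V"
proof -
  interpret group_module G K V by fact
  have "act V g (\<ominus>\<^bsub>V\<^esub> v) = \<ominus>\<^bsub>V\<^esub> act V g v" if "g \<in> carrier G" "v \<in> carrier V" for g v
    using that act_smult[of g "\<ominus>\<^bsub>K\<^esub> \<one>\<^bsub>K\<^esub>" v] by (simp add: V.smult_l_minus act_closed)
  moreover have "act V g \<zero>\<^bsub>V\<^esub> = \<zero>\<^bsub>V\<^esub>" if "g \<in> carrier G" for g
    using that act_smult[of g "\<zero>\<^bsub>K\<^esub>" "\<zero>\<^bsub>V\<^esub>"] by (simp add: act_closed)
  ultimately show ?thesis
    using assms(2) by (intro V.submoduleI) (auto simp: fixed_points_def act_add act_smult subset_iff)
qed

theorem module_Hom_module:
  assumes "group_module G K V" and "group_module G K W"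
  shows "module K (Hom_module G K V W)"
proof -
  interpret V: group_module G K V by fact
  interpret W: group_module G K W by fact
  let ?F = "fun_module (carrier V) W"
  let ?L = "?F\<lparr>carrier := linear_maps K V W\<rparr>"
  let ?H = "{f \<in> linear_maps K V W. \<forall>g\<in>carrier G. \<forall>v\<in>carrier V. f (act V g v) = act W g (f v)}"
  interpret L: module K ?L
    by (rule submodule_module) (intro module_fun_module submodule_linear_maps V.V.module_axioms W.V.module_axioms)+
  have c: "f x \<in> carrier W" if "f \<in> linear_maps K V W" "x \<in> carrier V" for f x
    using that by (auto simp: linear_maps_def)
  have m: "\<ominus>\<^bsub>?L\<^esub> f = (\<ominus>\<^bsub>K\<^esub> \<one>\<^bsub>K\<^esub>) \<odot>\<^bsub>?L\<^esub> f" if "f \<in> linear_maps K V W" for f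
    by (rule minus_eq_smult) (use that L.module_axioms in auto)
  have s: "a \<odot>\<^bsub>?L\<^esub> f \<in> ?H" if "a \<in> carrier K" "f \<in> ?H" for a f
    using that L.smult_closed[of a f] by (simp add: fun_module_def V.act_closed W.act_smult c)
  have "submodule ?H K ?L"
  proof (rule L.submoduleI)
    fix f g assume "f \<in> ?H" "g \<in> ?H"
    then show "f \<oplus>\<^bsub>?L\<^esub> g \<in> ?H"
      using L.a_closed[of f g] by (simp add: fun_module_def V.act_closed W.act_add c)
  next
    show "\<zero>\<^bsub>?L\<^esub> \<in> ?H"
      using L.zero_closed W.act_smult[of _ "\<zero>\<^bsub>K\<^esub>" "\<zero>\<^bsub>W\<^esub>"]
      by (simp add: fun_module_def V.act_closed W.act_closed)
  next
    fix f assume f: "f \<in> ?H"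
    then show "\<ominus>\<^bsub>?L\<^esub> f \<in> ?H" using s[OF _ f, of "\<ominus>\<^bsub>K\<^esub> \<one>\<^bsub>K\<^esub>"] m[of f] by simp
  qed (use s in auto)
  from submodule_module[OF L.module_axioms this] show ?thesis
    by (simp add: Hom_module_def)
qed

theorem module_H1:
  assumes "group_module G K V"
  shows "submodule (cocycles G V) K (fun_module (carrier G) V)"
    and "submodule (coboundaries G V) K ((fun_module (carrier G) V)\<lparr>carrier := cocycles G V\<rparr>)"
    and "module K (H1 G V)"
proof -
  interpret group_module G K V by fact
  let ?F = "fun_module (carrier G) V"
  let ?Z = "?F\<lparr>carrier := cocycles G V\<rparr>"
  interpret F: module K ?F by (rule module_fun_module) (rule V.module_axioms)
  have am: "act V g (\<ominus>\<^bsub>V\<^esub> v) = \<ominus>\<^bsub>V\<^esub> act V g v" if "g \<in> carrier G" "v \<in> carrier V" for g v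
    using that act_smult[of g "\<ominus>\<^bsub>K\<^esub> \<one>\<^bsub>K\<^esub>" v] by (simp add: V.smult_l_minus act_closed)
  have az: "act V g \<zero>\<^bsub>V\<^esub> = \<zero>\<^bsub>V\<^esub>" if "g \<in> carrier G" for g
    using that act_smult[of g "\<zero>\<^bsub>K\<^esub>" "\<zero>\<^bsub>V\<^esub>"] by (simp add: act_closed)
  have c: "\<delta> g \<in> carrier V" if "\<delta> \<in> cocycles G V" "g \<in> carrier G" for \<delta> g
    using that by (auto simp: cocycles_def)
  have mF: "\<ominus>\<^bsub>?F\<^esub> f = (\<ominus>\<^bsub>K\<^esub> \<one>\<^bsub>K\<^esub>) \<odot>\<^bsub>?F\<^esub> f" if "f \<in> carrier ?F" for f
    by (rule minus_eq_smult) (use that F.module_axioms in auto)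
  have sZ: "a \<odot>\<^bsub>?F\<^esub> \<delta> \<in> cocycles G V" if "a \<in> carrier K" "\<delta> \<in> cocycles G V" for a \<delta>
    using that c[of \<delta>] by (auto simp: cocycles_def fun_module_def V.smult_r_distr act_smult act_closed)
  have ZF: "cocycles G V \<subseteq> carrier ?F" by (auto simp: cocycles_def fun_module_def)
  show Z: "submodule (cocycles G V) K ?F"
  proof (rule F.submoduleI)
    fix \<delta> \<epsilon> assume "\<delta> \<in> cocycles G V" "\<epsilon> \<in> cocycles G V"
    then show "\<delta> \<oplus>\<^bsub>?F\<^esub> \<epsilon> \<in> cocycles G V"
      using c[of \<delta>] c[of \<epsilon>] by (auto simp: cocycles_def fun_module_def act_add act_closed V.a_ac)
  next
    fix \<delta> assume d: "\<delta> \<in> cocycles G V"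
    then show "\<ominus>\<^bsub>?F\<^esub> \<delta> \<in> cocycles G V" using mF[of \<delta>] sZ[OF _ d] ZF by auto
  qed (use ZF sZ in \<open>auto simp: cocycles_def fun_module_def az\<close>)
  interpret Z: module K ?Z by (rule submodule_module) (fact F.module_axioms Z)+
  have mZ: "\<ominus>\<^bsub>?Z\<^esub> f = (\<ominus>\<^bsub>K\<^esub> \<one>\<^bsub>K\<^esub>) \<odot>\<^bsub>?Z\<^esub> f" if "f \<in> cocycles G V" for f
    by (rule minus_eq_smult) (use that Z.module_axioms in auto)
  let ?b = "\<lambda>v. \<lambda>g\<in>carrier G. act V g v \<ominus>\<^bsub>V\<^esub> v"
  have BZ: "?b v \<in> cocycles G V" if v: "v \<in> carrier V" for v
    using that by (auto simp: cocycles_def act_closed act_mult act_add am a_minus_def V.a_ac V.r_neg1 V.r_neg2)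
  have sB: "a \<odot>\<^bsub>?Z\<^esub> ?b v = ?b (a \<odot>\<^bsub>V\<^esub> v)" if "a \<in> carrier K" "v \<in> carrier V" for a v
    using that by (auto simp: fun_module_def fun_eq_iff a_minus_def V.smult_r_distr V.smult_r_minus act_smult act_closed)
  have aB: "?b v \<oplus>\<^bsub>?Z\<^esub> ?b w = ?b (v \<oplus>\<^bsub>V\<^esub> w)" if "v \<in> carrier V" "w \<in> carrier V" for v w
    using that by (auto simp: fun_module_def fun_eq_iff a_minus_def V.minus_add act_add act_closed V.a_ac)
  show B: "submodule (coboundaries G V) K ?Z"
  proof (rule Z.submoduleI)
    show "coboundaries G V \<subseteq> carrier ?Z" using BZ by (auto simp: coboundaries_def)
    have "\<zero>\<^bsub>?Z\<^esub> = ?b \<zero>\<^bsub>V\<^esub>" by (auto simp: fun_module_def fun_eq_iff az a_minus_def V.minus_equality[of "\<zero>\<^bsub>V\<^esub>" "\<zero>\<^bsub>V\<^esub>"])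
    then show "\<zero>\<^bsub>?Z\<^esub> \<in> coboundaries G V" unfolding coboundaries_def by blast
  next
    fix \<delta> \<epsilon> assume "\<delta> \<in> coboundaries G V" "\<epsilon> \<in> coboundaries G V"
    then show "\<delta> \<oplus>\<^bsub>?Z\<^esub> \<epsilon> \<in> coboundaries G V"
      unfolding coboundaries_def using aB V.a_closed by blast
  next
    fix a \<delta> assume "a \<in> carrier K" "\<delta> \<in> coboundaries G V"
    then show "a \<odot>\<^bsub>?Z\<^esub> \<delta> \<in> coboundaries G V"
      unfolding coboundaries_def using sB V.smult_closed by blast
  next
    fix \<delta> assume d: "\<delta> \<in> coboundaries G V"
    then obtain v where v: "v \<in> carrier V" "\<delta> = ?b v" unfolding coboundaries_def by blast
    then have "\<ominus>\<^bsub>?Z\<^esub> \<delta> = ?b ((\<ominus>\<^bsub>K\<^esub> \<one>\<^bsub>K\<^esub>) \<odot>\<^bsub>V\<^esub> v)"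
      using mZ[OF BZ] sB by simp
    then show "\<ominus>\<^bsub>?Z\<^esub> \<delta> \<in> coboundaries G V"
      unfolding coboundaries_def using v V.smult_closed by blast
  qed
  show "module K (H1 G V)"
    unfolding H1_def by (rule module_quotient_module) (fact Z.module_axioms B)+
qed

end

theory Submission
  imports Defs
begin

text \<open>
  Put \<open>N = O\<^sub>r'(H) = O\<^sup>r(H)\<close>. The \<open>r\<close>-group \<open>H/N\<close> has no nonzero fixed points on \<open>V\<^sup>N\<close>, so \<open>V\<^sup>N = 0\<close>;
  as \<open>|N|\<close> is invertible in \<open>K\<close>, this gives \<open>H\<^sup>1(H,V) = 0\<close>. Hence the restriction to \<open>H\<close> of a cocycle \<open>\<delta>\<close>
  of \<open>G\<close> is the coboundary of a unique vector \<open>v\<close>, and \<open>g \<mapsto> \<delta> g - g v\<close> is a function on \<open>G/H\<close>.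
  Composing it with linear forms on \<open>V\<close> gives functions in \<open>\<L>\<close>, which depend equivariantly on the form up to
  constants. The inverse of the resulting map \<open>H\<^sup>1(G,V) \<rightarrow> Hom\<^sub>G(V\<^sup>*, \<L>/k)\<close> lifts a homomorphism to functions
  vanishing at the coset \<open>H\<close> and uses that \<open>V\<close> is reflexive.
\<close>

section \<open>Fixed points of groups with normal subgroups of prime power index\<close>

text \<open>The isomorphism is a connecting map written out by hand. Applying Hom_K(V*, -) to the
  sequence k -> L -> L/k turns its terms into V, V tensor L and Hom_K(V*, L/k), because V is
  finite-dimensional, and V tensor L is induced from the restriction of V to H. Its G-fixed points
  are V^H = 0 and, by Shapiro's lemma, its first cohomology is H^1(H,V) = 0; so Hom_G(V*, L/k) ->
  H^1(G,V) is bijective. On cocycles the two vanishing statements become uniqueness and existence of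
  the vector v. The quotient by k is forced: left translation by x changes the function attached to
  a cocycle by the vector \<open>\<delta> x\<close>, which a linear form turns into a constant. The
  obstacle in the group-theoretic half is that orbit counting for r-groups needs a finite set, while
  a nonzero space over an algebraically closed field is infinite.\<close>

lemma (in ring) add_pow_one_eq_zero_iff:
  assumes "ring_char R = r" and "r > 0"
  shows "add_pow R n \<one> = \<zero> \<longleftrightarrow> r dvd (n::nat)"
proof -
  let ?P = "\<lambda>n::nat. n > 0 \<and> add_pow R n \<one> = \<zero>"
  \<comment> \<open>The default value 0 of \<open>ring_char\<close> is excluded by
    \<open>r > 0\<close>, so the \<open>LEAST\<close> branch applies.\<close>
  have ex: "\<exists>n. ?P n" using assms unfolding ring_char_def by (metis less_numeral_extra(3))
  then have r: "r = (LEAST n. ?P n)" using assms unfolding ring_char_def by simp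
  have P: "?P r" unfolding r using ex by (rule LeastI_ex)
  have least: "m = 0" if "m < r" "add_pow R m \<one> = \<zero>" for m
    using not_less_Least[of m ?P] that unfolding r by (meson neq0_conv)
  have mul: "add_pow R (r * q) \<one> = \<zero>" for q
    using P add.nat_pow_pow[of \<one> q r] by simp
  have "add_pow R n \<one> = add_pow R (r * (n div r)) \<one> \<oplus> add_pow R (n mod r) \<one>"
    using add.nat_pow_mult[of \<one> "r * (n div r)" "n mod r"] by simp
  then have "add_pow R n \<one> = add_pow R (n mod r) \<one>" by (simp only: mul) simp
  moreover have "n mod r < r" using assms(2) by simp
  moreover have "add_pow R (0::nat) \<one> = \<zero>" by simp
  ultimately show ?thesis unfolding dvd_eq_mod_eq_0 using least by metis
qed

text \<open>The theorem supplies only \<open>r > 0\<close>. Primality, on which the two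
  characteristic subgroups and the orbit counting rest, comes from the absence of zero divisors
  among the multiples of one.\<close>

lemma (in domain) prime_ring_char:
  assumes "ring_char R = r" and "r > 0"
  shows "Factorial_Ring.prime r"
proof -
  note iff = add_pow_one_eq_zero_iff[OF assms]
  have "r dvd a \<or> r dvd b" if "r dvd a * b" for a b
  proof -
    have "(add_pow R a \<one>) \<otimes> (add_pow R b \<one>) = add_pow R (a * b) \<one>"
      using add.nat_pow_pow[of \<one> a b] by (simp add: add_pow_ldistr mult.commute)
    also have "\<dots> = \<zero>" using that iff by blast
    finally show ?thesis using integral iff by blast
  qed
  moreover have "r \<noteq> 1" using iff[of 1] by auto
  ultimately show ?thesis
    using assms(2) by (intro prime_elem_nat_iff[THEN iffD1] prime_elemI) auto
qed

text \<open>Every stabilizer contains \<open>N\<close>, so orbit lengths divide the index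
  \<open>p ^ n\<close>, and an orbit of moved points has length divisible by \<open>p\<close>.
  Letting \<open>G\<close> act with \<open>N\<close> acting trivially avoids constructing an action
  of the quotient group.\<close>

lemma (in group_action) prime_dvd_card_nonfixed:
  assumes fin: "finite (carrier G)" "finite E" and p: "Factorial_Ring.prime p"
    and N: "subgroup N G" and ord: "order G = p ^ n * card N"
    and triv: "\<And>g x. g \<in> N \<Longrightarrow> x \<in> E \<Longrightarrow> \<phi> g x = x"
  shows "p dvd card {x \<in> E. \<exists>g\<in>carrier G. \<phi> g x \<noteq> x}"
proof -
  interpret group G using group_hom group_hom.axioms(1) by blast
  \<comment> \<open>The indicator function of the moved points: summing it orbit by orbit counts
    them.\<close>
  let ?f = "\<lambda>x. if \<exists>g\<in>carrier G. \<phi> g x \<noteq> x then 1 else 0 :: nat"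
  have "p dvd (\<Sum>x\<in>orbit G \<phi> x. ?f x)" if x: "x \<in> E" for x
  proof (cases "\<exists>g\<in>carrier G. \<phi> g x \<noteq> x")
    case False
    then have "orbit G \<phi> x = {x}" unfolding orbit_def by (auto intro!: exI[of _ \<one>])
    then show ?thesis using False by auto
  next
    case True
    have sub: "orbit G \<phi> x \<subseteq> E" using element_image x unfolding orbit_def by auto
    have nf: "\<exists>g\<in>carrier G. \<phi> g y \<noteq> y" if y: "y \<in> orbit G \<phi> x" for y
    proof (rule ccontr)
      assume nex: "\<not> ?thesis"
      then have "orbit G \<phi> y = {y}" unfolding orbit_def by (auto intro!: exI[of _ \<one>])
      moreover have "x \<in> orbit G \<phi> y" using orbit_sym x y sub by blast
      ultimately show False using True nex by auto
    qed
    have st: "subgroup (stabilizer G \<phi> x) G" using stabilizer_subgroup x by blast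
    have "N \<subseteq> stabilizer G \<phi> x"
      using triv x subgroup.mem_carrier[OF N] by (auto simp: stabilizer_def)
    then have "subgroup N (G\<lparr>carrier := stabilizer G \<phi> x\<rparr>)" using N st subgroup_incl by blast
    from group.lagrange[OF subgroup_imp_group[OF st] this]
    have "card (rcosets\<^bsub>G\<lparr>carrier := stabilizer G \<phi> x\<rparr>\<^esub> N) * card N = card (stabilizer G \<phi> x)"
      by (simp add: order_def)
    then have "card N dvd card (stabilizer G \<phi> x)" by (metis dvd_triv_right)
    then obtain k where k: "card (stabilizer G \<phi> x) = card N * k" by (rule dvdE)
    have "card N > 0" using card_pos fin(1) N by blast
    moreover have "card (orbit G \<phi> x) * (card N * k) = p ^ n * card N"
      using orbit_stabilizer_theorem[OF x] ord k by simp
    ultimately have "card (orbit G \<phi> x) * k = p ^ n" by (simp add: ac_simps)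
    then have "card (orbit G \<phi> x) dvd p ^ n" by (metis dvd_triv_left)
    then obtain i where i: "card (orbit G \<phi> x) = p ^ i" using p divides_primepow_nat by blast
    have "orbit G \<phi> x \<noteq> {x}" using True by (auto simp: orbit_def)
    then have "card (orbit G \<phi> x) \<noteq> 1"
      using orbit_refl[OF x] by (metis card_1_singletonE singletonD)
    then have "p dvd card (orbit G \<phi> x)" using i by (cases i) auto
    moreover have "(\<Sum>x\<in>orbit G \<phi> x. ?f x) = card (orbit G \<phi> x)" using nf by simp
    ultimately show ?thesis by simp
  qed
  then have "p dvd (\<Sum>orb\<in>orbits G E \<phi>. \<Sum>x\<in>orb. ?f x)"
    unfolding orbits_def by - (rule dvd_sum, blast)
  also have "\<dots> = (\<Sum>x\<in>E. ?f x)" by (rule disjoint_sum[OF fin(2)])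
  also have "\<dots> = card {x \<in> E. \<exists>g\<in>carrier G. \<phi> g x \<noteq> x}"
    using fin(2) by (subst sum.If_cases) (auto simp: Int_def)
  finally show ?thesis .
qed


lemma (in module) add_pow_eq_smult:
  assumes "x \<in> carrier M"
  shows "add_pow M (n::nat) x = add_pow R n \<one> \<odot>\<^bsub>M\<^esub> x"
  by (induction n) (use assms in \<open>auto simp: smult_l_distr\<close>)

context group_module
begin

lemma act_zero: "g \<in> carrier G \<Longrightarrow> act V g \<zero>\<^bsub>V\<^esub> = \<zero>\<^bsub>V\<^esub>"
  using act_smult[of g "\<zero>\<^bsub>K\<^esub>" "\<zero>\<^bsub>V\<^esub>"] by (simp add: act_closed)

lemma act_minus: "\<lbrakk>g \<in> carrier G; v \<in> carrier V\<rbrakk> \<Longrightarrow> act V g (\<ominus>\<^bsub>V\<^esub> v) = \<ominus>\<^bsub>V\<^esub> act V g v"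
  using act_smult[of g "\<ominus>\<^bsub>K\<^esub> \<one>\<^bsub>K\<^esub>" v] by (simp add: V.smult_l_minus act_closed)

lemma act_inv: "\<lbrakk>g \<in> carrier G; v \<in> carrier V\<rbrakk> \<Longrightarrow> act V (inv\<^bsub>G\<^esub> g) (act V g v) = v"
  by (simp add: act_mult[symmetric] act_one)

lemma act_finsum:
  assumes "g \<in> carrier G" and "f \<in> A \<rightarrow> carrier V"
  shows "act V g (\<Oplus>\<^bsub>V\<^esub>a\<in>A. f a) = (\<Oplus>\<^bsub>V\<^esub>a\<in>A. act V g (f a))"
  using assms(2)
proof (induction A rule: infinite_finite_induct)
  case (insert a A)
  then show ?case using assms(1) by (simp add: Pi_iff act_add act_closed)
qed (use assms(1) in \<open>simp_all add: act_zero\<close>)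

lemma group_module_subgroup: "subgroup H G \<Longrightarrow> group_module (G\<lparr>carrier := H\<rparr>) K V"
  by (intro group_module.intro group_module_axioms.intro)
    (auto simp: V.module_axioms G.subgroup_imp_group act_closed act_add act_smult act_one act_mult subgroup.mem_carrier)

text \<open>The inverse of the action of \<open>g\<close> is the action of its group inverse. The
  restriction to \<open>S\<close> is there because \<open>Bij S\<close> consists of extensional
  functions.\<close>

lemma group_action_stable:
  assumes S: "S \<subseteq> carrier V" and st: "\<And>g s. \<lbrakk>g \<in> carrier G; s \<in> S\<rbrakk> \<Longrightarrow> act V g s \<in> S"
  shows "group_action G S (\<lambda>g. \<lambda>s\<in>S. act V g s)"
proof -
  have bij: "(\<lambda>s\<in>S. act V g s) \<in> Bij S" if "g \<in> carrier G" for g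
    unfolding Bij_def
    using that S st act_inv[of g] act_inv[of "inv\<^bsub>G\<^esub> g"]
    by (auto intro!: bij_betw_byWitness[where f' = "act V (inv\<^bsub>G\<^esub> g)"] simp: subset_iff)
  show ?thesis
    unfolding group_action_def
    by (intro group_hom.intro group_hom_axioms.intro homI G.group_axioms group_BijGroup)
      (use S st bij in \<open>auto simp: BijGroup_def compose_def act_mult fun_eq_iff subset_iff\<close>)
qed

text \<open>
  If \<open>v \<noteq> 0\<close> is fixed by \<open>N\<close>, then the span \<open>S\<close> of its \<open>G\<close>-orbit over the prime field is finite of
  order divisible by \<open>r\<close>, and all orbits of the \<open>r\<close>-group \<open>G/N\<close> on \<open>S\<close> have \<open>r\<close>-power length, so
  that \<open>0\<close> is not the only fixed point in \<open>S\<close>.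
\<close>

lemma fixed_points_normal_eq_zero:
  assumes fin: "finite (carrier G)" and dom: "domain K" and r: "ring_char K = r" "r > 0"
    and N: "N \<lhd> G" and ord: "order (G Mod N) = r ^ n"
    and fix0: "fixed_points (carrier G) V = {\<zero>\<^bsub>V\<^esub>}"
  shows "fixed_points N V = {\<zero>\<^bsub>V\<^esub>}"
proof (rule ccontr)
  interpret N: normal N G by fact
  have p: "Factorial_Ring.prime r" using domain.prime_ring_char[OF dom r] .
  note iff = V.R.add_pow_one_eq_zero_iff[OF r]
  assume "fixed_points N V \<noteq> {\<zero>\<^bsub>V\<^esub>}"
  moreover have "\<zero>\<^bsub>V\<^esub> \<in> fixed_points N V" by (simp add: fixed_points_def act_zero)
  ultimately obtain v where v: "v \<in> carrier V" "v \<noteq> \<zero>\<^bsub>V\<^esub>" and vN: "\<And>n. n \<in> N \<Longrightarrow> act V n v = v"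
    by (auto simp: fixed_points_def)
  \<comment> \<open>Normality moves \<open>n\<close> past \<open>h\<close> as a conjugate in
    \<open>N\<close>, so the whole orbit of \<open>v\<close> is fixed by \<open>N\<close>.\<close>
  have vN': "act V n (act V h v) = act V h v" if "n \<in> N" "h \<in> carrier G" for n h
  proof -
    have "n \<otimes>\<^bsub>G\<^esub> h = h \<otimes>\<^bsub>G\<^esub> (inv\<^bsub>G\<^esub> h \<otimes>\<^bsub>G\<^esub> n \<otimes>\<^bsub>G\<^esub> h)" using that by (simp add: G.m_assoc[symmetric])
    then have "act V n (act V h v) = act V h (act V (inv\<^bsub>G\<^esub> h \<otimes>\<^bsub>G\<^esub> n \<otimes>\<^bsub>G\<^esub> h) v)"
      using that v by (metis N.mem_carrier act_mult G.inv_closed G.m_closed)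
    then show ?thesis using vN N.inv_op_closed1 that by simp
  qed
  \<comment> \<open>\<open>F\<close> is the prime field, obtained as the multiples of one. What the
    argument uses is that it is finite, contains zero and one, and is closed under addition.\<close>
  define F where "F = range (\<lambda>n::nat. add_pow K n \<one>\<^bsub>K\<^esub>)"
  have FK: "F \<subseteq> carrier K" by (auto simp: F_def)
  have "add_pow K m \<one>\<^bsub>K\<^esub> = add_pow K (m mod r) \<one>\<^bsub>K\<^esub>" for m :: nat
  proof -
    have "add_pow K m \<one>\<^bsub>K\<^esub> = add_pow K (r * (m div r)) \<one>\<^bsub>K\<^esub> \<oplus>\<^bsub>K\<^esub> add_pow K (m mod r) \<one>\<^bsub>K\<^esub>"
      using V.R.add.nat_pow_mult[of "\<one>\<^bsub>K\<^esub>" "r * (m div r)" "m mod r"] by simp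
    then show ?thesis using iff[of "r * (m div r)"] by simp
  qed
  then have "F \<subseteq> (\<lambda>n. add_pow K n \<one>\<^bsub>K\<^esub>) ` {..<r}"
    using r(2) by (auto simp: F_def intro!: image_eqI[of _ _ "_ mod r"])
  then have finF: "finite F" by (rule finite_subset) simp
  have F0: "\<zero>\<^bsub>K\<^esub> \<in> F" "\<one>\<^bsub>K\<^esub> \<in> F"
    using rangeI[of "\<lambda>n::nat. add_pow K n \<one>\<^bsub>K\<^esub>" 0] rangeI[of "\<lambda>n::nat. add_pow K n \<one>\<^bsub>K\<^esub>" 1]
    by (simp_all add: F_def)
  have Fadd: "a \<oplus>\<^bsub>K\<^esub> b \<in> F" if "a \<in> F" "b \<in> F" for a b
    using that by (auto simp: F_def V.R.add.nat_pow_mult)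
  \<comment> \<open>Coefficients are indexed by the group rather than by the orbit of
    \<open>v\<close>, with repetitions allowed. Addition is then coefficientwise, and the action
    only reindexes coefficients.\<close>
  define s where "s c = (\<Oplus>\<^bsub>V\<^esub>h\<in>carrier G. c h \<odot>\<^bsub>V\<^esub> act V h v)" for c
  define S where "S = s ` (carrier G \<rightarrow>\<^sub>E F)"
  have sI: "s c \<in> S" if "c \<in> carrier G \<rightarrow> F" for c
  proof -
    have "s c = s (restrict c (carrier G))"
      using that FK v unfolding s_def by (intro V.finsum_cong') (auto simp: act_closed)
    then show ?thesis using that by (auto simp: S_def)
  qed
  have cl: "(\<lambda>h. c h \<odot>\<^bsub>V\<^esub> act V h v) \<in> carrier G \<rightarrow> carrier V" if "c \<in> carrier G \<rightarrow> F" for c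
    using that FK v by (auto simp: act_closed)
  have SV: "S \<subseteq> carrier V"
    unfolding S_def s_def by (auto simp: PiE_iff intro!: V.finsum_closed cl)
  have finS: "finite S" using fin finF by (simp add: S_def finite_PiE)
  have Sadd: "x \<oplus>\<^bsub>V\<^esub> y \<in> S" if xy: "x \<in> S" "y \<in> S" for x y
  proof -
    obtain c d where c: "c \<in> carrier G \<rightarrow> F" "x = s c" and d: "d \<in> carrier G \<rightarrow> F" "y = s d"
      using xy by (auto simp: S_def PiE_def)
    have "x \<oplus>\<^bsub>V\<^esub> y = (\<Oplus>\<^bsub>V\<^esub>h\<in>carrier G. c h \<odot>\<^bsub>V\<^esub> act V h v \<oplus>\<^bsub>V\<^esub> d h \<odot>\<^bsub>V\<^esub> act V h v)"
      unfolding c d s_def using cl c d by (simp add: V.finsum_addf)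
    also have "\<dots> = s (\<lambda>h. c h \<oplus>\<^bsub>K\<^esub> d h)"
      unfolding s_def using c d FK v
      by (intro V.finsum_cong') (auto simp: V.smult_l_distr act_closed Pi_iff subset_iff)
    finally show ?thesis using sI c d Fadd by (simp add: Pi_iff)
  qed
  have Sact: "act V g x \<in> S" if g: "g \<in> carrier G" and x: "x \<in> S" for g x
  proof -
    obtain c where c: "c \<in> carrier G \<rightarrow> F" "x = s c" using x by (auto simp: S_def PiE_def)
    \<comment> \<open>Acting by \<open>g\<close> carries the coefficient at \<open>h\<close> to
      \<open>g h\<close>, so the new coefficient at \<open>h\<close> is the old one at
      \<open>inv g h\<close>.\<close>
    have inj: "inj_on (\<lambda>h. inv\<^bsub>G\<^esub> g \<otimes>\<^bsub>G\<^esub> h) (carrier G)" using g by (simp add: inj_on_def)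
    have img: "(\<lambda>h. inv\<^bsub>G\<^esub> g \<otimes>\<^bsub>G\<^esub> h) ` carrier G = carrier G"
      using G.surj_const_mult[of "inv\<^bsub>G\<^esub> g"] g by simp
    have "act V g x = (\<Oplus>\<^bsub>V\<^esub>h\<in>carrier G. act V g (c h \<odot>\<^bsub>V\<^esub> act V h v))"
      unfolding c s_def using cl[OF c(1)] g by (intro act_finsum)
    also have "\<dots> = (\<Oplus>\<^bsub>V\<^esub>h\<in>(\<lambda>h. inv\<^bsub>G\<^esub> g \<otimes>\<^bsub>G\<^esub> h) ` carrier G. c h \<odot>\<^bsub>V\<^esub> act V (g \<otimes>\<^bsub>G\<^esub> h) v)"
      unfolding img using c FK v g
      by (intro V.finsum_cong') (auto simp: act_smult act_mult act_closed Pi_iff subset_iff)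
    also have "\<dots> = (\<Oplus>\<^bsub>V\<^esub>h\<in>carrier G. c (inv\<^bsub>G\<^esub> g \<otimes>\<^bsub>G\<^esub> h) \<odot>\<^bsub>V\<^esub> act V (g \<otimes>\<^bsub>G\<^esub> (inv\<^bsub>G\<^esub> g \<otimes>\<^bsub>G\<^esub> h)) v)"
      using c FK v g inj by (intro V.finsum_reindex) (auto simp: act_closed Pi_iff subset_iff)
    also have "\<dots> = s (\<lambda>h. c (inv\<^bsub>G\<^esub> g \<otimes>\<^bsub>G\<^esub> h))"
      unfolding s_def using c FK v g
      by (intro V.finsum_cong') (auto simp: act_closed Pi_iff subset_iff G.m_assoc[symmetric])
    finally show ?thesis using sI c g by (simp add: Pi_iff)
  qed
  have "s (\<lambda>_. \<zero>\<^bsub>K\<^esub>) = (\<Oplus>\<^bsub>V\<^esub>h\<in>carrier G. \<zero>\<^bsub>V\<^esub>)"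
    unfolding s_def using v by (intro V.finsum_cong') (auto simp: act_closed)
  then have S0: "\<zero>\<^bsub>V\<^esub> \<in> S" using sI[of "\<lambda>_. \<zero>\<^bsub>K\<^esub>"] F0 by simp
  have vS: "v \<in> S"
  proof -
    have "s (\<lambda>h. if h = \<one>\<^bsub>G\<^esub> then \<one>\<^bsub>K\<^esub> else \<zero>\<^bsub>K\<^esub>)
        = (\<Oplus>\<^bsub>V\<^esub>h\<in>carrier G. if \<one>\<^bsub>G\<^esub> = h then act V h v else \<zero>\<^bsub>V\<^esub>)"
      unfolding s_def using v by (intro V.finsum_cong') (auto simp: act_closed)
    also have "\<dots> = v" using fin v by (subst V.finsum_singleton) (auto simp: act_closed act_one)
    finally show ?thesis using sI[of "\<lambda>h. if h = \<one>\<^bsub>G\<^esub> then \<one>\<^bsub>K\<^esub> else \<zero>\<^bsub>K\<^esub>"] F0 by auto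
  qed
  have rv: "add_pow V r x = \<zero>\<^bsub>V\<^esub>" if "x \<in> carrier V" for x
    using V.add_pow_eq_smult[OF that, of r] iff[of r] that by simp
  have Spow: "add_pow V (n::nat) x \<in> S" if "x \<in> S" for x n
    by (induction n) (use that S0 Sadd in auto)
  have sub: "subgroup S (add_monoid V)"
  proof (rule V.add.subgroupI)
    fix x assume x: "x \<in> S"
    then have xV: "x \<in> carrier V" using SV by blast
    \<comment> \<open>In characteristic \<open>r\<close> the negative of \<open>x\<close> is an
      \<open>(r - 1)\<close>-fold sum, so closure under addition already gives inverses.\<close>
    have "add_pow V (r - 1) x \<oplus>\<^bsub>V\<^esub> x = \<zero>\<^bsub>V\<^esub>"
      using rv[OF xV] r(2) by (cases r) (simp_all add: xV)
    then have "\<ominus>\<^bsub>V\<^esub> x = add_pow V (r - 1) x" using xV by (intro V.minus_equality) auto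
    then show "\<ominus>\<^bsub>V\<^esub> x \<in> S" using Spow[OF x] by simp
  qed (use SV S0 Sadd in auto)
  interpret A: group "add_monoid V\<lparr>carrier := S\<rparr>" using V.add.subgroup_imp_group[OF sub] .
  \<comment> \<open>The nonzero vector \<open>v\<close> has additive order \<open>r\<close>, and the
    order of an element divides the order of the group \<open>S\<close>.\<close>
  have "v [^]\<^bsub>add_monoid V\<lparr>carrier := S\<rparr>\<^esub> r = \<one>\<^bsub>add_monoid V\<lparr>carrier := S\<rparr>\<^esub>"
    using rv[OF v(1)] unfolding V.add.nat_pow_consistent[symmetric] by (simp add: add_pow_def)
  then have "A.ord v dvd r" using A.pow_eq_id vS by simp
  moreover have "A.ord v \<noteq> 1" using A.ord_eq_1 vS v(2) by simp
  ultimately have "A.ord v = r" using p prime_nat_iff by blast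
  then have rS: "r dvd card S" using A.ord_dvd_group_order[of v] vS by (simp add: order_def)
  interpret act: group_action G S "\<lambda>g. \<lambda>s\<in>S. act V g s" using group_action_stable SV Sact by blast
  have "act V n x = x" if n: "n \<in> N" and x: "x \<in> S" for n x
  proof -
    obtain c where c: "c \<in> carrier G \<rightarrow> F" "x = s c" using x by (auto simp: S_def PiE_def)
    have "act V n x = (\<Oplus>\<^bsub>V\<^esub>h\<in>carrier G. act V n (c h \<odot>\<^bsub>V\<^esub> act V h v))"
      unfolding c s_def using cl[OF c(1)] n by (intro act_finsum) auto
    also have "\<dots> = s c"
      unfolding s_def using c FK v n
      by (intro V.finsum_cong') (auto simp: act_smult act_closed Pi_iff subset_iff vN')
    finally show ?thesis using c by simp
  qed
  moreover have "order G = r ^ n * card N"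
    using G.lagrange[OF N.subgroup_axioms] ord by (simp add: FactGroup_def order_def)
  ultimately have "r dvd card {x \<in> S. \<exists>g\<in>carrier G. (\<lambda>s\<in>S. act V g s) x \<noteq> x}"
    by (intro act.prime_dvd_card_nonfixed[OF fin finS p N.subgroup_axioms, where n = n]) simp_all
  also have "{x \<in> S. \<exists>g\<in>carrier G. (\<lambda>s\<in>S. act V g s) x \<noteq> x} = S - {\<zero>\<^bsub>V\<^esub>}"
    using fix0 SV by (auto simp: fixed_points_def act_zero)
  finally have "r dvd card S - 1" using finS S0 by simp
  then have "r dvd card S - (card S - 1)" using rS by (metis dvd_diff_nat)
  moreover have "card S > 0" using finS S0 card_gt_0_iff by blast
  ultimately show False using p by simp
qed

end

section \<open>Vanishing of the first cohomology\<close>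

lemma (in abelian_group) minus_eq_iff:
  "\<lbrakk>a \<in> carrier G; b \<in> carrier G; c \<in> carrier G\<rbrakk> \<Longrightarrow> a \<ominus> b = c \<longleftrightarrow> a = c \<oplus> b"
  using add.inv_solve_right'[of c a b] by (simp add: minus_eq eq_commute[of c])

text \<open>This is the cocycle identity for a cocycle minus a coboundary: read \<open>a\<close>,
  \<open>b\<close> as \<open>\<delta> g\<close>, \<open>g (\<delta> h)\<close> and \<open>c\<close>,
  \<open>d\<close>, \<open>e\<close> as \<open>g h v\<close>, \<open>g v\<close>,
  \<open>v\<close>.\<close>

lemma (in abelian_group) minus_telescope:
  assumes "a \<in> carrier G" "b \<in> carrier G" "c \<in> carrier G" "d \<in> carrier G" "e \<in> carrier G"
  shows "(a \<oplus> b) \<ominus> (c \<ominus> e) = (a \<ominus> (d \<ominus> e)) \<oplus> (b \<ominus> (c \<ominus> d))"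
proof -
  have "d \<oplus> (b \<oplus> (\<ominus> d \<oplus> \<ominus> c)) = b \<oplus> \<ominus> c"
    using assms by (simp add: a_lcomm[of d b] r_neg2)
  then show ?thesis using assms by (simp add: a_minus_def minus_add a_ac)
qed

context group_module
begin

lemma cocycle_closed: "\<lbrakk>\<delta> \<in> cocycles G V; g \<in> carrier G\<rbrakk> \<Longrightarrow> \<delta> g \<in> carrier V"
  by (auto simp: cocycles_def)

lemma cocycle_mult:
  "\<lbrakk>\<delta> \<in> cocycles G V; g \<in> carrier G; h \<in> carrier G\<rbrakk> \<Longrightarrow> \<delta> (g \<otimes>\<^bsub>G\<^esub> h) = \<delta> g \<oplus>\<^bsub>V\<^esub> act V g (\<delta> h)"
  by (auto simp: cocycles_def)

text \<open>The difference of the two vectors is fixed by \<open>H\<close>. This is the uniqueness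
  of the vector whose coboundary is a given cocycle on \<open>H\<close>.\<close>

lemma eq_of_coboundary_eq:
  assumes "fixed_points H V = {\<zero>\<^bsub>V\<^esub>}" and H: "H \<subseteq> carrier G"
    and v: "v \<in> carrier V" "w \<in> carrier V"
    and eq: "\<And>h. h \<in> H \<Longrightarrow> act V h v \<ominus>\<^bsub>V\<^esub> v = act V h w \<ominus>\<^bsub>V\<^esub> w"
  shows "v = w"
proof -
  have "act V h (v \<ominus>\<^bsub>V\<^esub> w) = v \<ominus>\<^bsub>V\<^esub> w" if h: "h \<in> H" for h
  proof -
    have hG: "h \<in> carrier G" using h H by blast
    have "act V h v = act V h w \<ominus>\<^bsub>V\<^esub> w \<oplus>\<^bsub>V\<^esub> v"
      using eq[OF h] v hG by (metis V.M.add.inv_solve_right' V.M.minus_closed a_minus_def act_closed V.M.add.inv_closed V.M.add.m_assoc V.M.l_neg V.M.r_zero)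
    then show ?thesis
      using v hG by (simp add: a_minus_def act_add act_minus act_closed V.M.a_ac V.M.r_neg V.M.r_neg1 V.M.r_neg2)
  qed
  then have "v \<ominus>\<^bsub>V\<^esub> w \<in> fixed_points H V" using v by (simp add: fixed_points_def)
  then show ?thesis using assms(1) v by (simp add: V.M.minus_eq_iff)
qed

text \<open>\<open>v\<close> is minus the average of \<open>\<delta>\<close> over \<open>N\<close>.\<close>

lemma cocycle_coboundary_on_subgroup:
  assumes fld: "field K" and N: "subgroup N G" and fin: "finite N"
    and card: "add_pow K (card N) \<one>\<^bsub>K\<^esub> \<noteq> \<zero>\<^bsub>K\<^esub>" and \<delta>: "\<delta> \<in> cocycles G V"
  shows "\<exists>v\<in>carrier V. \<forall>n\<in>N. \<delta> n = act V n v \<ominus>\<^bsub>V\<^esub> v"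
proof -
  interpret N: subgroup N G by fact
  interpret K: field K by fact
  let ?c = "add_pow K (card N) \<one>\<^bsub>K\<^esub>"
  define s where "s = (\<Oplus>\<^bsub>V\<^esub>n\<in>N. \<delta> n)"
  have \<delta>N: "\<delta> \<in> N \<rightarrow> carrier V" using cocycle_closed[OF \<delta>] by auto
  have s: "s \<in> carrier V" unfolding s_def using \<delta>N by (rule V.finsum_closed)
  have c: "?c \<in> Units K" using card by (simp add: K.field_Units)
  \<comment> \<open>Left translation by \<open>m\<close> permutes \<open>N\<close>, so
    \<open>s\<close> is also the sum of the \<open>\<delta> (m n)\<close>; the cocycle identity
    splits it. Dividing by the invertible scalar \<open>?c\<close> then expresses
    \<open>\<delta> m\<close> as a coboundary.\<close>
  have avg: "s = ?c \<odot>\<^bsub>V\<^esub> \<delta> m \<oplus>\<^bsub>V\<^esub> act V m s" if m: "m \<in> N" for m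
  proof -
    have inj: "inj_on (\<lambda>n. m \<otimes>\<^bsub>G\<^esub> n) N" using m by (auto simp: inj_on_def)
    have img: "(\<lambda>n. m \<otimes>\<^bsub>G\<^esub> n) ` N = N"
      using inj fin m by (intro endo_inj_surj) auto
    have "s = (\<Oplus>\<^bsub>V\<^esub>n\<in>(\<lambda>n. m \<otimes>\<^bsub>G\<^esub> n) ` N. \<delta> n)" by (simp only: s_def img)
    also have "\<dots> = (\<Oplus>\<^bsub>V\<^esub>n\<in>N. \<delta> (m \<otimes>\<^bsub>G\<^esub> n))"
      using inj \<delta>N m by (intro V.finsum_reindex) auto
    also have "\<dots> = (\<Oplus>\<^bsub>V\<^esub>n\<in>N. \<delta> m \<oplus>\<^bsub>V\<^esub> act V m (\<delta> n))"
      using m by (intro V.finsum_cong') (auto simp: cocycle_mult[OF \<delta>] cocycle_closed[OF \<delta>] act_closed)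
    also have "\<dots> = (\<Oplus>\<^bsub>V\<^esub>n\<in>N. \<delta> m) \<oplus>\<^bsub>V\<^esub> (\<Oplus>\<^bsub>V\<^esub>n\<in>N. act V m (\<delta> n))"
      using m by (intro V.finsum_addf) (auto simp: cocycle_closed[OF \<delta>] act_closed)
    also have "(\<Oplus>\<^bsub>V\<^esub>n\<in>N. \<delta> m) = ?c \<odot>\<^bsub>V\<^esub> \<delta> m"
      using m \<delta>N V.add.finprod_const[of "\<delta> m" N] by (simp add: V.add_pow_eq_smult Pi_iff)
    also have "(\<Oplus>\<^bsub>V\<^esub>n\<in>N. act V m (\<delta> n)) = act V m s"
      unfolding s_def using m \<delta>N by (intro act_finsum[symmetric]) auto
    finally show ?thesis .
  qed
  define v where "v = \<ominus>\<^bsub>V\<^esub> (inv\<^bsub>K\<^esub> ?c \<odot>\<^bsub>V\<^esub> s)"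
  have "\<delta> m = act V m v \<ominus>\<^bsub>V\<^esub> v" if m: "m \<in> N" for m
  proof -
    have m': "m \<in> carrier G" "\<delta> m \<in> carrier V" using m \<delta>N by auto
    have "inv\<^bsub>K\<^esub> ?c \<odot>\<^bsub>V\<^esub> s = inv\<^bsub>K\<^esub> ?c \<odot>\<^bsub>V\<^esub> (?c \<odot>\<^bsub>V\<^esub> \<delta> m \<oplus>\<^bsub>V\<^esub> act V m s)" using avg[OF m] by simp
    also have "\<dots> = \<delta> m \<oplus>\<^bsub>V\<^esub> act V m (inv\<^bsub>K\<^esub> ?c \<odot>\<^bsub>V\<^esub> s)"
      using s m' c by (simp add: V.smult_r_distr act_closed act_smult V.smult_assoc1[symmetric])
    finally have "inv\<^bsub>K\<^esub> ?c \<odot>\<^bsub>V\<^esub> s \<ominus>\<^bsub>V\<^esub> act V m (inv\<^bsub>K\<^esub> ?c \<odot>\<^bsub>V\<^esub> s) = \<delta> m"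
      using s m' c V.M.minus_eq_iff by (simp add: act_closed)
    then show ?thesis
      using s m' c by (simp add: v_def act_minus a_minus_def act_closed V.M.minus_minus V.M.a_comm)
  qed
  moreover have "v \<in> carrier V" using s c by (simp add: v_def)
  ultimately show ?thesis by blast
qed

text \<open>
  After subtracting a coboundary, \<open>\<delta>\<close> vanishes on \<open>N = O\<^sub>r'(G) = O\<^sup>r(G)\<close>; then \<open>\<delta>\<close> is constant on
  the cosets of \<open>N\<close> and takes values in the fixed points of \<open>N\<close>, which are zero.
\<close>

lemma cocycle_coboundary:
  assumes fin: "finite (carrier G)" and fld: "field K" and r: "ring_char K = r" "r > 0"
    and core: "core_prime_to r G = residual_subgroup r G"
    and fix0: "fixed_points (carrier G) V = {\<zero>\<^bsub>V\<^esub>}" and \<delta>: "\<delta> \<in> cocycles G V"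
  shows "\<exists>v\<in>carrier V. \<forall>g\<in>carrier G. \<delta> g = act V g v \<ominus>\<^bsub>V\<^esub> v"
proof -
  interpret K: field K by fact
  have p: "Factorial_Ring.prime r" using K.prime_ring_char[OF r] .
  define N where "N = core_prime_to r G"
  have N: "N \<lhd> G" and card: "\<not> r dvd card N"
    using core_prime_to[OF G.group_axioms fin p] by (simp_all add: N_def)
  \<comment> \<open>The equality of the two characteristic subgroups gives \<open>N\<close> both
    properties at once: order prime to \<open>r\<close> for averaging, and index a power of
    \<open>r\<close> for the fixed point argument.\<close>
  obtain n where ord: "order (G Mod N) = r ^ n"
    using residual_subgroup(2)[OF G.group_axioms fin p] core by (auto simp: N_def)
  interpret N: normal N G by fact
  have "finite N" using fin N.subset finite_subset by blast
  moreover have "add_pow K (card N) \<one>\<^bsub>K\<^esub> \<noteq> \<zero>\<^bsub>K\<^esub>" using card V.R.add_pow_one_eq_zero_iff[OF r] by blast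
  ultimately obtain v where v: "v \<in> carrier V" and vN: "\<And>n. n \<in> N \<Longrightarrow> \<delta> n = act V n v \<ominus>\<^bsub>V\<^esub> v"
    using cocycle_coboundary_on_subgroup[OF fld N.subgroup_axioms _ _ \<delta>] by blast
  have fixN: "fixed_points N V = {\<zero>\<^bsub>V\<^esub>}"
    using fixed_points_normal_eq_zero[OF fin K.domain_axioms r N ord fix0] .
  define \<epsilon> where "\<epsilon> g = \<delta> g \<ominus>\<^bsub>V\<^esub> (act V g v \<ominus>\<^bsub>V\<^esub> v)" for g
  have \<epsilon>c: "\<epsilon> g \<in> carrier V" if "g \<in> carrier G" for g
    using that v cocycle_closed[OF \<delta>] by (simp add: \<epsilon>_def act_closed)
  have \<epsilon>m: "\<epsilon> (g \<otimes>\<^bsub>G\<^esub> h) = \<epsilon> g \<oplus>\<^bsub>V\<^esub> act V g (\<epsilon> h)" if "g \<in> carrier G" "h \<in> carrier G" for g h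
    using that v cocycle_closed[OF \<delta>]
    V.M.minus_telescope[of "\<delta> g" "act V g (\<delta> h)" "act V g (act V h v)" "act V g v" v]
    by (simp add: \<epsilon>_def cocycle_mult[OF \<delta>] act_mult act_closed)
      (simp add: a_minus_def act_add act_minus act_closed)
  have \<epsilon>N: "\<epsilon> n = \<zero>\<^bsub>V\<^esub>" if "n \<in> N" for n
    using that v vN by (simp add: \<epsilon>_def act_closed V.M.r_neg a_minus_def)
  have "\<epsilon> g = \<zero>\<^bsub>V\<^esub>" if g: "g \<in> carrier G" for g
  proof -
    have "act V n (\<epsilon> g) = \<epsilon> g" if n: "n \<in> N" for n
    proof -
      \<comment> \<open>The value of \<open>\<epsilon>\<close> at \<open>n g\<close> is computed
        twice: from the factorization with \<open>n\<close> on the left it is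
        \<open>n (\<epsilon> g)\<close>, and from \<open>g\<close> times a conjugate of
        \<open>n\<close> lying in \<open>N\<close> it is \<open>\<epsilon> g\<close>.\<close>
      have n': "inv\<^bsub>G\<^esub> g \<otimes>\<^bsub>G\<^esub> n \<otimes>\<^bsub>G\<^esub> g \<in> N" using N.inv_op_closed1 g n by simp
      have "act V n (\<epsilon> g) = \<epsilon> (n \<otimes>\<^bsub>G\<^esub> g)" using \<epsilon>m[of n g] \<epsilon>N n g by (simp add: act_closed \<epsilon>c)
      also have "n \<otimes>\<^bsub>G\<^esub> g = g \<otimes>\<^bsub>G\<^esub> (inv\<^bsub>G\<^esub> g \<otimes>\<^bsub>G\<^esub> n \<otimes>\<^bsub>G\<^esub> g)" using g n by (simp add: G.m_assoc[symmetric])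
      also have "\<epsilon> \<dots> = \<epsilon> g" using \<epsilon>m[of g] \<epsilon>N n' g by (simp add: act_zero \<epsilon>c)
      finally show ?thesis .
    qed
    then show ?thesis using fixN \<epsilon>c[OF g] by (auto simp: fixed_points_def)
  qed
  then have "\<delta> g = act V g v \<ominus>\<^bsub>V\<^esub> v" if "g \<in> carrier G" for g
    using \<epsilon>_def that v cocycle_closed[OF \<delta>] V.M.minus_eq_iff[of "\<delta> g" "act V g v \<ominus>\<^bsub>V\<^esub> v" "\<zero>\<^bsub>V\<^esub>"]
    by (simp add: act_closed)
  then show ?thesis using v by blast
qed

end

section \<open>Finite-dimensional duality\<close>

context module
begin

lemma lincomb_add:
  assumes "B \<subseteq> carrier M" "c \<in> B \<rightarrow> carrier R" "d \<in> B \<rightarrow> carrier R"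
  shows "(\<Oplus>\<^bsub>M\<^esub>b\<in>B. c b \<odot>\<^bsub>M\<^esub> b) \<oplus>\<^bsub>M\<^esub> (\<Oplus>\<^bsub>M\<^esub>b\<in>B. d b \<odot>\<^bsub>M\<^esub> b) = (\<Oplus>\<^bsub>M\<^esub>b\<in>B. (c b \<oplus> d b) \<odot>\<^bsub>M\<^esub> b)"
proof -
  have "(\<Oplus>\<^bsub>M\<^esub>b\<in>B. (c b \<oplus> d b) \<odot>\<^bsub>M\<^esub> b) = (\<Oplus>\<^bsub>M\<^esub>b\<in>B. c b \<odot>\<^bsub>M\<^esub> b \<oplus>\<^bsub>M\<^esub> d b \<odot>\<^bsub>M\<^esub> b)"
    using assms by (intro M.finsum_cong') (auto simp: smult_l_distr Pi_iff subset_iff)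
  also have "\<dots> = (\<Oplus>\<^bsub>M\<^esub>b\<in>B. c b \<odot>\<^bsub>M\<^esub> b) \<oplus>\<^bsub>M\<^esub> (\<Oplus>\<^bsub>M\<^esub>b\<in>B. d b \<odot>\<^bsub>M\<^esub> b)"
    using assms by (intro M.finsum_addf) (auto simp: Pi_iff subset_iff)
  finally show ?thesis ..
qed

lemma lincomb_smult:
  assumes "finite B" "B \<subseteq> carrier M" "c \<in> B \<rightarrow> carrier R" "a \<in> carrier R"
  shows "a \<odot>\<^bsub>M\<^esub> (\<Oplus>\<^bsub>M\<^esub>b\<in>B. c b \<odot>\<^bsub>M\<^esub> b) = (\<Oplus>\<^bsub>M\<^esub>b\<in>B. (a \<otimes> c b) \<odot>\<^bsub>M\<^esub> b)"
proof -
  have "a \<odot>\<^bsub>M\<^esub> (\<Oplus>\<^bsub>M\<^esub>b\<in>B. c b \<odot>\<^bsub>M\<^esub> b) = (\<Oplus>\<^bsub>M\<^esub>b\<in>B. a \<odot>\<^bsub>M\<^esub> (c b \<odot>\<^bsub>M\<^esub> b))"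
    using assms by (intro finsum_smult_ldistr) (auto simp: Pi_iff subset_iff)
  also have "\<dots> = (\<Oplus>\<^bsub>M\<^esub>b\<in>B. (a \<otimes> c b) \<odot>\<^bsub>M\<^esub> b)"
    using assms by (intro M.finsum_cong') (auto simp: smult_assoc1 Pi_iff subset_iff)
  finally show ?thesis .
qed

lemma lincomb_closed:
  "\<lbrakk>B \<subseteq> carrier M; c \<in> B \<rightarrow> carrier R\<rbrakk> \<Longrightarrow> (\<Oplus>\<^bsub>M\<^esub>b\<in>B. c b \<odot>\<^bsub>M\<^esub> b) \<in> carrier M"
  by (intro M.finsum_closed) (auto simp: Pi_iff subset_iff)

text \<open>A spanning set of least cardinality is independent, since a vector with nonzero
  coefficient in a relation could be dropped.\<close>

lemma obtain_basis:
  assumes "field R" and "finite_dimensional R M"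
  obtains B where "finite B" and "B \<subseteq> carrier M"
    and "\<And>x. x \<in> carrier M \<Longrightarrow> \<exists>c\<in>B \<rightarrow> carrier R. x = (\<Oplus>\<^bsub>M\<^esub>b\<in>B. c b \<odot>\<^bsub>M\<^esub> b)"
    and "\<And>c b. \<lbrakk>c \<in> B \<rightarrow> carrier R; (\<Oplus>\<^bsub>M\<^esub>b\<in>B. c b \<odot>\<^bsub>M\<^esub> b) = \<zero>\<^bsub>M\<^esub>; b \<in> B\<rbrakk> \<Longrightarrow> c b = \<zero>"
proof -
  interpret R: field R by fact
  let ?P = "\<lambda>B. finite B \<and> B \<subseteq> carrier M \<and>
    (\<forall>x\<in>carrier M. \<exists>c\<in>B \<rightarrow> carrier R. x = (\<Oplus>\<^bsub>M\<^esub>b\<in>B. c b \<odot>\<^bsub>M\<^esub> b))"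
  obtain B0 where "?P B0" using assms(2) unfolding finite_dimensional_def by blast
  from ex_has_least_nat[of ?P, OF this, of card]
  obtain B where P: "?P B" and min: "\<And>B'. ?P B' \<Longrightarrow> card B \<le> card B'" by blast
  have BM: "B \<subseteq> carrier M" and fin: "finite B" using P by auto
  have "c b = \<zero>" if c: "c \<in> B \<rightarrow> carrier R" and 0: "(\<Oplus>\<^bsub>M\<^esub>b\<in>B. c b \<odot>\<^bsub>M\<^esub> b) = \<zero>\<^bsub>M\<^esub>" and b: "b \<in> B" for c b
  proof (rule ccontr)
    assume "c b \<noteq> \<zero>"
    then have u: "c b \<in> Units R" using c b by (auto simp: R.field_Units)
    have "?P (B - {b})"
    proof (intro conjI ballI)
      fix x assume "x \<in> carrier M"
      then obtain d where d: "d \<in> B \<rightarrow> carrier R" "x = (\<Oplus>\<^bsub>M\<^esub>b\<in>B. d b \<odot>\<^bsub>M\<^esub> b)" using P by blast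
      \<comment> \<open>Adding \<open>a\<close> times the relation to the expansion of
        \<open>x\<close> cancels the coefficient of \<open>b\<close>.\<close>
      define a where "a = \<ominus> (d b \<otimes> inv (c b))"
      have a: "a \<in> carrier R" using d b u by (auto simp: a_def)
      have ac: "(\<lambda>b. a \<otimes> c b) \<in> B \<rightarrow> carrier R" using a c by auto
      have e: "(\<lambda>b. d b \<oplus> a \<otimes> c b) \<in> B \<rightarrow> carrier R" using a c d by auto
      have "x = x \<oplus>\<^bsub>M\<^esub> a \<odot>\<^bsub>M\<^esub> (\<Oplus>\<^bsub>M\<^esub>b\<in>B. c b \<odot>\<^bsub>M\<^esub> b)" using 0 a \<open>x \<in> carrier M\<close> by simp
      also have "\<dots> = (\<Oplus>\<^bsub>M\<^esub>b\<in>B. (d b \<oplus> a \<otimes> c b) \<odot>\<^bsub>M\<^esub> b)"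
        unfolding d(2) lincomb_smult[OF fin BM c a] by (rule lincomb_add[OF BM d(1) ac])
      also have "\<dots> = (\<Oplus>\<^bsub>M\<^esub>b\<in>insert b (B - {b}). (d b \<oplus> a \<otimes> c b) \<odot>\<^bsub>M\<^esub> b)"
        using b by (simp add: insert_absorb)
      also have "\<dots> = (d b \<oplus> a \<otimes> c b) \<odot>\<^bsub>M\<^esub> b \<oplus>\<^bsub>M\<^esub> (\<Oplus>\<^bsub>M\<^esub>b\<in>B - {b}. (d b \<oplus> a \<otimes> c b) \<odot>\<^bsub>M\<^esub> b)"
        using fin b e BM by (subst M.finsum_insert) (auto simp: Pi_iff subset_iff)
      also have "a \<otimes> c b = \<ominus> d b"
        using d b u c by (simp add: a_def R.l_minus R.m_assoc Pi_iff)
      also have "(d b \<oplus> \<ominus> d b) \<odot>\<^bsub>M\<^esub> b = \<zero>\<^bsub>M\<^esub>" using d b BM by (auto simp: R.r_neg Pi_iff)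
      finally have "x = (\<Oplus>\<^bsub>M\<^esub>b\<in>B - {b}. (d b \<oplus> a \<otimes> c b) \<odot>\<^bsub>M\<^esub> b)"
        using lincomb_closed[of "B - {b}" "\<lambda>b. d b \<oplus> a \<otimes> c b"] e BM by (simp add: Pi_iff subset_iff)
      then show "\<exists>c\<in>B - {b} \<rightarrow> carrier R. x = (\<Oplus>\<^bsub>M\<^esub>b\<in>B - {b}. c b \<odot>\<^bsub>M\<^esub> b)"
        using e by (intro bexI[of _ "\<lambda>b. d b \<oplus> a \<otimes> c b"]) auto
    qed (use fin BM in auto)
    then have "card B \<le> card (B - {b})" by (rule min)
    moreover have "card (B - {b}) < card B" using fin b by (rule card_Diff1_less)
    ultimately show False by simp
  qed
  with P show ?thesis by (intro that[of B]) auto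
qed

text \<open>Independence makes the coefficients of an expansion unique, and uniqueness makes each
  coordinate a linear function.\<close>

lemma obtain_dual_basis:
  assumes "field R" and "finite_dimensional R M"
  obtains B \<beta> where "finite B" and "B \<subseteq> carrier M"
    and "\<And>b. b \<in> B \<Longrightarrow> \<beta> b \<in> linear_maps R M (base_module R)"
    and "\<And>x. x \<in> carrier M \<Longrightarrow> x = (\<Oplus>\<^bsub>M\<^esub>b\<in>B. \<beta> b x \<odot>\<^bsub>M\<^esub> b)"
proof -
  obtain B where fin: "finite B" and BM: "B \<subseteq> carrier M"
    and span: "\<And>x. x \<in> carrier M \<Longrightarrow> \<exists>c\<in>B \<rightarrow> carrier R. x = (\<Oplus>\<^bsub>M\<^esub>b\<in>B. c b \<odot>\<^bsub>M\<^esub> b)"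
    and ind: "\<And>c b. \<lbrakk>c \<in> B \<rightarrow> carrier R; (\<Oplus>\<^bsub>M\<^esub>b\<in>B. c b \<odot>\<^bsub>M\<^esub> b) = \<zero>\<^bsub>M\<^esub>; b \<in> B\<rbrakk> \<Longrightarrow> c b = \<zero>"
    using obtain_basis[OF assms] by blast
  obtain e where e: "\<And>x. x \<in> carrier M \<Longrightarrow> e x \<in> B \<rightarrow> carrier R"
    and xe: "\<And>x. x \<in> carrier M \<Longrightarrow> x = (\<Oplus>\<^bsub>M\<^esub>b\<in>B. e x b \<odot>\<^bsub>M\<^esub> b)"
    using span by metis
  have uniq: "c b = d b" if c: "c \<in> B \<rightarrow> carrier R" and d: "d \<in> B \<rightarrow> carrier R"
    and eq: "(\<Oplus>\<^bsub>M\<^esub>b\<in>B. c b \<odot>\<^bsub>M\<^esub> b) = (\<Oplus>\<^bsub>M\<^esub>b\<in>B. d b \<odot>\<^bsub>M\<^esub> b)" and b: "b \<in> B" for c d b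
  proof -
    let ?d = "\<lambda>b. \<ominus> \<one> \<otimes> d b"
    have d': "?d \<in> B \<rightarrow> carrier R" using d by auto
    have "(\<Oplus>\<^bsub>M\<^esub>b\<in>B. (c b \<oplus> ?d b) \<odot>\<^bsub>M\<^esub> b) = (\<Oplus>\<^bsub>M\<^esub>b\<in>B. c b \<odot>\<^bsub>M\<^esub> b) \<oplus>\<^bsub>M\<^esub> \<ominus> \<one> \<odot>\<^bsub>M\<^esub> (\<Oplus>\<^bsub>M\<^esub>b\<in>B. d b \<odot>\<^bsub>M\<^esub> b)"
      using lincomb_add[OF BM c d'] lincomb_smult[OF fin BM d, of "\<ominus> \<one>"] by simp
    also have "\<dots> = \<zero>\<^bsub>M\<^esub>" using lincomb_closed[OF BM d] by (simp add: eq smult_l_minus M.r_neg)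
    finally have "c b \<oplus> ?d b = \<zero>" using c d b by (intro ind[of "\<lambda>b. c b \<oplus> ?d b"]) auto
    then have "c b \<ominus> d b = \<zero>" using d b by (auto simp: R.l_minus a_minus_def Pi_iff)
    then show ?thesis using R.minus_eq_iff[of "c b" "d b" \<zero>] c d b by (auto simp: Pi_iff)
  qed
  define \<beta> where "\<beta> b = (\<lambda>x\<in>carrier M. e x b)" for b
  have "\<beta> b \<in> linear_maps R M (base_module R)" if b: "b \<in> B" for b
  proof -
    have "e (x \<oplus>\<^bsub>M\<^esub> y) b = e x b \<oplus> e y b" if x: "x \<in> carrier M" and y: "y \<in> carrier M" for x y
      using lincomb_add[OF BM e[OF x] e[OF y], symmetric] e x y
      by (intro uniq[OF _ _ _ b, of "e (x \<oplus>\<^bsub>M\<^esub> y)" "\<lambda>b. e x b \<oplus> e y b"])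
        (auto simp: Pi_iff xe[symmetric])
    moreover have "e (a \<odot>\<^bsub>M\<^esub> x) b = a \<otimes> e x b" if a: "a \<in> carrier R" and x: "x \<in> carrier M" for a x
      using lincomb_smult[OF fin BM e[OF x] a, symmetric] e x a
      by (intro uniq[OF _ _ _ b, of "e (a \<odot>\<^bsub>M\<^esub> x)" "\<lambda>b. a \<otimes> e x b"])
        (auto simp: Pi_iff xe[symmetric])
    ultimately show ?thesis
      using e b by (auto simp: linear_maps_def base_module_def \<beta>_def Pi_iff)
  qed
  moreover have "x = (\<Oplus>\<^bsub>M\<^esub>b\<in>B. \<beta> b x \<odot>\<^bsub>M\<^esub> b)" if "x \<in> carrier M" for x
    using xe[OF that] that by (simp add: \<beta>_def)
  ultimately show ?thesis using that fin BM by blast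
qed

end

lemma linear_map_closed: "\<lbrakk>f \<in> linear_maps K M N; x \<in> carrier M\<rbrakk> \<Longrightarrow> f x \<in> carrier N"
  by (auto simp: linear_maps_def)

lemma carrier_base_module [simp]: "carrier (base_module K) = carrier K"
  by (simp add: base_module_def)

lemma linear_map_finsum:
  assumes "module K M" and "module K N" and "f \<in> linear_maps K M N"
    and "finite A" and "g \<in> A \<rightarrow> carrier M"
  shows "f (\<Oplus>\<^bsub>M\<^esub>a\<in>A. g a) = (\<Oplus>\<^bsub>N\<^esub>a\<in>A. f (g a))"
proof -
  interpret M: module K M by fact
  interpret N: module K N by fact
  have f: "f x \<in> carrier N" if "x \<in> carrier M" for x using that assms(3) by (rule linear_map_closed[rotated])
  have "f (\<zero>\<^bsub>K\<^esub> \<odot>\<^bsub>M\<^esub> \<zero>\<^bsub>M\<^esub>) = \<zero>\<^bsub>K\<^esub> \<odot>\<^bsub>N\<^esub> f \<zero>\<^bsub>M\<^esub>" using assms(3) M.R.zero_closed M.zero_closed unfolding linear_maps_def by blast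
  then have f0: "f \<zero>\<^bsub>M\<^esub> = \<zero>\<^bsub>N\<^esub>" using f by simp
  show ?thesis using assms(4,5)
  proof induction
    case (insert a A)
    then show ?case using assms(3) f by (simp add: linear_maps_def Pi_iff)
  qed (simp add: f0)
qed

lemma linear_functionals_separate:
  assumes "module K M" and "field K" and "finite_dimensional K M"
    and "x \<in> carrier M" and "y \<in> carrier M"
    and eq: "\<And>f. f \<in> linear_maps K M (base_module K) \<Longrightarrow> f x = f y"
  shows "x = y"
proof -
  interpret M: module K M by fact
  obtain B \<beta> where B: "finite B" "B \<subseteq> carrier M"
    "\<And>b. b \<in> B \<Longrightarrow> \<beta> b \<in> linear_maps K M (base_module K)"
    "\<And>x. x \<in> carrier M \<Longrightarrow> x = (\<Oplus>\<^bsub>M\<^esub>b\<in>B. \<beta> b x \<odot>\<^bsub>M\<^esub> b)"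
    using M.obtain_dual_basis[OF assms(2,3)] by blast
  have "(\<Oplus>\<^bsub>M\<^esub>b\<in>B. \<beta> b x \<odot>\<^bsub>M\<^esub> b) = (\<Oplus>\<^bsub>M\<^esub>b\<in>B. \<beta> b y \<odot>\<^bsub>M\<^esub> b)"
  proof (intro M.finsum_cong')
    show "(\<lambda>b. \<beta> b y \<odot>\<^bsub>M\<^esub> b) \<in> B \<rightarrow> carrier M"
      using B(2) linear_map_closed[OF B(3) assms(5)] by auto
  qed (use eq[OF B(3)] in auto)
  then show ?thesis using B(4)[OF assms(4)] B(4)[OF assms(5)] by simp
qed

text \<open>A functional \<open>f\<close> is the sum of the \<open>f b\<close> times
  \<open>\<beta> b\<close>, so \<open>\<phi>\<close> is determined by its values on the coordinate
  forms; the vector with coordinates \<open>\<phi> (\<beta> b)\<close> represents it.\<close>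

lemma double_dual_evaluation:
  fixes K M
  defines "D \<equiv> (fun_module (carrier M) (base_module K))\<lparr>carrier := linear_maps K M (base_module K)\<rparr>"
  assumes "module K M" and "field K" and "finite_dimensional K M"
    and \<phi>: "\<phi> \<in> linear_maps K D (base_module K)"
  shows "\<exists>x\<in>carrier M. \<forall>f\<in>linear_maps K M (base_module K). \<phi> f = f x"
proof -
  interpret M: module K M by fact
  let ?K = "base_module K"
  interpret k: module K ?K by (rule module_base_module) (rule M.R.is_cring)
  interpret D: module K D
    unfolding D_def by (intro submodule_module module_fun_module submodule_linear_maps k.module_axioms M.module_axioms)
  obtain B \<beta> where B: "finite B" "B \<subseteq> carrier M"
    "\<And>b. b \<in> B \<Longrightarrow> \<beta> b \<in> linear_maps K M ?K"
    "\<And>x. x \<in> carrier M \<Longrightarrow> x = (\<Oplus>\<^bsub>M\<^esub>b\<in>B. \<beta> b x \<odot>\<^bsub>M\<^esub> b)"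
    using M.obtain_dual_basis[OF assms(3,4)] by blast
  have cD: "carrier D = linear_maps K M ?K" by (simp add: D_def)
  have sk: "a \<odot>\<^bsub>?K\<^esub> c = a \<otimes>\<^bsub>K\<^esub> c" for a c by (simp add: base_module_def)
  have lc: "f x \<in> carrier K" if "f \<in> linear_maps K M ?K" "x \<in> carrier M" for f x
    using that by (auto simp: linear_maps_def)
  have \<phi>c: "\<phi> f \<in> carrier K" if "f \<in> linear_maps K M ?K" for f
    using that \<phi> by (auto simp: linear_maps_def[of K D] cD)
  \<comment> \<open>Evaluation at a vector is itself linear on \<open>D\<close>; this is what lets
    it pass through a finite sum taken in \<open>D\<close>.\<close>
  have ev: "(\<lambda>f\<in>carrier D. f x) \<in> linear_maps K D ?K" if x: "x \<in> carrier M" for x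
  proof -
    have "(f \<oplus>\<^bsub>D\<^esub> g) x = f x \<oplus>\<^bsub>?K\<^esub> g x" "(a \<odot>\<^bsub>D\<^esub> f) x = a \<odot>\<^bsub>?K\<^esub> f x" for f g a
      using x by (simp_all add: D_def fun_module_def)
    moreover have "(\<lambda>f\<in>carrier D. f x) \<in> carrier D \<rightarrow>\<^sub>E carrier ?K" using lc x by (simp add: cD)
    ultimately show ?thesis unfolding linear_maps_def[of K D] by simp
  qed
  define x where "x = (\<Oplus>\<^bsub>M\<^esub>b\<in>B. \<phi> (\<beta> b) \<odot>\<^bsub>M\<^esub> b)"
  have x: "x \<in> carrier M" unfolding x_def using B \<phi>c by (intro M.lincomb_closed) auto
  have "\<phi> f = f x" if f: "f \<in> linear_maps K M ?K" for f
  proof -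
    have fb: "f b \<odot>\<^bsub>D\<^esub> \<beta> b \<in> carrier D" if "b \<in> B" for b
      using that B f lc by (intro D.smult_closed) (auto simp: cD)
    have fs: "(\<Oplus>\<^bsub>D\<^esub>b\<in>B. f b \<odot>\<^bsub>D\<^esub> \<beta> b) \<in> carrier D" using fb by (intro D.finsum_closed) auto
    have "f y = (\<Oplus>\<^bsub>D\<^esub>b\<in>B. f b \<odot>\<^bsub>D\<^esub> \<beta> b) y" if y: "y \<in> carrier M" for y
    proof -
      have "f y = f (\<Oplus>\<^bsub>M\<^esub>b\<in>B. \<beta> b y \<odot>\<^bsub>M\<^esub> b)" using B(4)[OF y] by simp
      also have "\<dots> = (\<Oplus>\<^bsub>?K\<^esub>b\<in>B. f (\<beta> b y \<odot>\<^bsub>M\<^esub> b))"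
        using B y lc f by (intro linear_map_finsum[OF M.module_axioms k.module_axioms f]) auto
      also have "\<dots> = (\<Oplus>\<^bsub>?K\<^esub>b\<in>B. (\<lambda>f\<in>carrier D. f y) (f b \<odot>\<^bsub>D\<^esub> \<beta> b))"
      proof (rule k.finsum_cong')
        fix b assume b: "b \<in> B"
        have "f (\<beta> b y \<odot>\<^bsub>M\<^esub> b) = \<beta> b y \<otimes>\<^bsub>K\<^esub> f b"
          using f b B lc y by (auto simp: linear_maps_def sk subset_iff)
        also have "\<dots> = (f b \<odot>\<^bsub>D\<^esub> \<beta> b) y"
          using b B f lc y by (auto simp: D_def fun_module_def sk M.R.m_comm subset_iff)
        finally show "f (\<beta> b y \<odot>\<^bsub>M\<^esub> b) = (\<lambda>f\<in>carrier D. f y) (f b \<odot>\<^bsub>D\<^esub> \<beta> b)"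
          using fb[OF b] by simp
      qed (use fb lc y in \<open>auto simp: cD\<close>)
      also have "\<dots> = (\<lambda>f\<in>carrier D. f y) (\<Oplus>\<^bsub>D\<^esub>b\<in>B. f b \<odot>\<^bsub>D\<^esub> \<beta> b)"
        using fb B by (intro linear_map_finsum[OF D.module_axioms k.module_axioms ev[OF y], symmetric]) auto
      finally show ?thesis using fs by simp
    qed
    then have "f = (\<Oplus>\<^bsub>D\<^esub>b\<in>B. f b \<odot>\<^bsub>D\<^esub> \<beta> b)"
      using f fs by (intro PiE_ext[of f "carrier M" "\<lambda>_. carrier ?K"]) (auto simp: cD linear_maps_def)
    then have "\<phi> f = \<phi> (\<Oplus>\<^bsub>D\<^esub>b\<in>B. f b \<odot>\<^bsub>D\<^esub> \<beta> b)" by simp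
    also have "\<dots> = (\<Oplus>\<^bsub>?K\<^esub>b\<in>B. \<phi> (f b \<odot>\<^bsub>D\<^esub> \<beta> b))"
      using fb B by (intro linear_map_finsum[OF D.module_axioms k.module_axioms \<phi>]) auto
    also have "\<dots> = (\<Oplus>\<^bsub>?K\<^esub>b\<in>B. f (\<phi> (\<beta> b) \<odot>\<^bsub>M\<^esub> b))"
    proof (rule k.finsum_cong')
      fix b assume b: "b \<in> B"
      have "\<phi> (f b \<odot>\<^bsub>D\<^esub> \<beta> b) = f b \<otimes>\<^bsub>K\<^esub> \<phi> (\<beta> b)"
        using \<phi> f lc b B by (auto simp: linear_maps_def[of K D] sk cD subset_iff)
      also have "\<dots> = f (\<phi> (\<beta> b) \<odot>\<^bsub>M\<^esub> b)"
        using f lc b B \<phi>c by (auto simp: linear_maps_def[of K M] sk M.R.m_comm subset_iff)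
      finally show "\<phi> (f b \<odot>\<^bsub>D\<^esub> \<beta> b) = f (\<phi> (\<beta> b) \<odot>\<^bsub>M\<^esub> b)" .
    qed (use lc f B \<phi>c in \<open>auto simp: subset_iff\<close>)
    also have "\<dots> = f x"
      unfolding x_def using B \<phi>c by (intro linear_map_finsum[OF M.module_axioms k.module_axioms f, symmetric]) auto
    finally show ?thesis .
  qed
  then show ?thesis using x by blast
qed

section \<open>Homomorphisms into the permutation module modulo constants\<close>

lemma coset_eqI:
  assumes "abelian_subgroup N M" and "x \<in> carrier M" and "n \<in> N"
  shows "N +>\<^bsub>M\<^esub> (n \<oplus>\<^bsub>M\<^esub> x) = N +>\<^bsub>M\<^esub> x"
proof -
  interpret abelian_subgroup N M by fact
  have "n \<oplus>\<^bsub>M\<^esub> x \<in> N +>\<^bsub>M\<^esub> x" using assms(3) by (auto simp: a_r_coset_def r_coset_def)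
  then show ?thesis using a_repr_independence' assms(2) by auto
qed

lemma coset_eqD:
  assumes "abelian_subgroup N M" and "x \<in> carrier M" and "N +>\<^bsub>M\<^esub> x = N +>\<^bsub>M\<^esub> y"
  shows "\<exists>n\<in>N. x = n \<oplus>\<^bsub>M\<^esub> y"
proof -
  interpret abelian_subgroup N M by fact
  have "x \<in> N +>\<^bsub>M\<^esub> y" using a_rcos_self[OF assms(2)] assms(3) by simp
  then show ?thesis by (auto simp: a_r_coset_def r_coset_def)
qed

text \<open>The first isomorphism theorem. Linearity of \<open>f\<close> is asked for on the carrier
  only, instead of membership in \<open>linear_maps\<close>, so \<open>f\<close> may be
  non-extensional.\<close>

lemma isomorphic_quotient_moduleI:
  assumes "module K M" and "module K W" and N: "submodule N K M"
    and closed: "\<And>x. x \<in> carrier M \<Longrightarrow> f x \<in> carrier W"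
    and add: "\<And>x y. \<lbrakk>x \<in> carrier M; y \<in> carrier M\<rbrakk> \<Longrightarrow> f (x \<oplus>\<^bsub>M\<^esub> y) = f x \<oplus>\<^bsub>W\<^esub> f y"
    and smult: "\<And>a x. \<lbrakk>a \<in> carrier K; x \<in> carrier M\<rbrakk> \<Longrightarrow> f (a \<odot>\<^bsub>M\<^esub> x) = a \<odot>\<^bsub>W\<^esub> f x"
    and ker: "\<And>x. x \<in> carrier M \<Longrightarrow> f x = \<zero>\<^bsub>W\<^esub> \<longleftrightarrow> x \<in> N"
    and surj: "\<And>w. w \<in> carrier W \<Longrightarrow> \<exists>x\<in>carrier M. f x = w"
  shows "isomorphic_modules K (quotient_module M N) W"
proof -
  interpret M: module K M by fact
  interpret W: module K W by fact
  interpret A: abelian_subgroup N M by (rule submodule_abelian_subgroup) fact+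
  let ?Q = "quotient_module M N"
  have eq: "f x = f y \<longleftrightarrow> N +>\<^bsub>M\<^esub> x = N +>\<^bsub>M\<^esub> y" if x: "x \<in> carrier M" and y: "y \<in> carrier M" for x y
  proof
    assume xy: "f x = f y"
    have x': "x = (x \<ominus>\<^bsub>M\<^esub> y) \<oplus>\<^bsub>M\<^esub> y" using M.M.minus_eq_iff[of x y "x \<ominus>\<^bsub>M\<^esub> y"] x y by simp
    then have "f x = f (x \<ominus>\<^bsub>M\<^esub> y) \<oplus>\<^bsub>W\<^esub> f y" using add[of "x \<ominus>\<^bsub>M\<^esub> y" y] x y by simp
    then have "f (x \<ominus>\<^bsub>M\<^esub> y) = \<zero>\<^bsub>W\<^esub>" 
      using W.M.minus_eq_iff[of "f x" "f y" "f (x \<ominus>\<^bsub>M\<^esub> y)"] W.M.minus_eq_iff[of "f x" "f y" "\<zero>\<^bsub>W\<^esub>"]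
        closed x y xy by simp
    then have "x \<ominus>\<^bsub>M\<^esub> y \<in> N" using ker x y by simp
    then show "N +>\<^bsub>M\<^esub> x = N +>\<^bsub>M\<^esub> y" using x' coset_eqI[OF A.abelian_subgroup_axioms y] by metis
  next
    assume "N +>\<^bsub>M\<^esub> x = N +>\<^bsub>M\<^esub> y"
    then obtain n where "n \<in> N" "x = n \<oplus>\<^bsub>M\<^esub> y" using coset_eqD[OF A.abelian_subgroup_axioms x] by blast
    then show "f x = f y" using add[of n y] ker[of n] y closed by simp
  qed
  \<comment> \<open>The representative is arbitrary; \<open>eq\<close> makes the value independent
    of it and also gives injectivity.\<close>
  define g where "g = (\<lambda>C\<in>carrier ?Q. f (SOME x. x \<in> carrier M \<and> C = N +>\<^bsub>M\<^esub> x))"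
  have g: "g (N +>\<^bsub>M\<^esub> x) = f x" if x: "x \<in> carrier M" for x
  proof -
    have "\<exists>y. y \<in> carrier M \<and> N +>\<^bsub>M\<^esub> x = N +>\<^bsub>M\<^esub> y" using x by blast
    from someI_ex[OF this] have "f (SOME y. y \<in> carrier M \<and> N +>\<^bsub>M\<^esub> x = N +>\<^bsub>M\<^esub> y) = f x"
      using eq x by metis
    then show ?thesis using x coset_in_quotient[of "N +>\<^bsub>M\<^esub> x" M N] by (auto simp: g_def)
  qed
  have S: "(N +>\<^bsub>M\<^esub> x) \<oplus>\<^bsub>?Q\<^esub> (N +>\<^bsub>M\<^esub> y) = N +>\<^bsub>M\<^esub> (x \<oplus>\<^bsub>M\<^esub> y)"
    if "x \<in> carrier M" "y \<in> carrier M" for x y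
    using that A.a_rcos_sum by (simp add: quotient_module_def)
  have "g \<in> linear_maps K ?Q W"
    unfolding linear_maps_def
    by (auto simp: coset_in_quotient S smult_quotient_module[OF assms(1) N] g add smult closed)
      (auto simp: g_def coset_in_quotient)
  moreover have "bij_betw g (carrier ?Q) (carrier W)"
    unfolding bij_betw_def inj_on_def
    using surj by (auto simp: coset_in_quotient g eq closed image_iff Bex_def) (metis g)
  ultimately show ?thesis unfolding isomorphic_modules_def by blast
qed

lemma quotient_gmodule_simps:
  assumes "group_module G K V" and N: "submodule N K V"
    and inv: "\<And>g x. g \<in> carrier G \<Longrightarrow> x \<in> N \<Longrightarrow> act V g x \<in> N"
  shows "\<And>x y. \<lbrakk>x \<in> carrier V; y \<in> carrier V\<rbrakk> \<Longrightarrow>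
      (N +>\<^bsub>V\<^esub> x) \<oplus>\<^bsub>quotient_gmodule V N\<^esub> (N +>\<^bsub>V\<^esub> y) = N +>\<^bsub>V\<^esub> (x \<oplus>\<^bsub>V\<^esub> y)"
    and "\<And>a x. \<lbrakk>a \<in> carrier K; x \<in> carrier V\<rbrakk> \<Longrightarrow>
      a \<odot>\<^bsub>quotient_gmodule V N\<^esub> (N +>\<^bsub>V\<^esub> x) = N +>\<^bsub>V\<^esub> (a \<odot>\<^bsub>V\<^esub> x)"
    and "\<And>g x. \<lbrakk>g \<in> carrier G; x \<in> carrier V\<rbrakk> \<Longrightarrow>
      act (quotient_gmodule V N) g (N +>\<^bsub>V\<^esub> x) = N +>\<^bsub>V\<^esub> act V g x"
    and "\<And>C. C \<in> carrier (quotient_gmodule V N) \<longleftrightarrow> (\<exists>x\<in>carrier V. C = N +>\<^bsub>V\<^esub> x)"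
    and "\<zero>\<^bsub>quotient_gmodule V N\<^esub> = N"
proof -
  interpret group_module G K V by fact
  interpret A: abelian_subgroup N V by (rule submodule_abelian_subgroup) (fact V.module_axioms N)+
  show "(N +>\<^bsub>V\<^esub> x) \<oplus>\<^bsub>quotient_gmodule V N\<^esub> (N +>\<^bsub>V\<^esub> y) = N +>\<^bsub>V\<^esub> (x \<oplus>\<^bsub>V\<^esub> y)"
    if "x \<in> carrier V" "y \<in> carrier V" for x y
    using that A.a_rcos_sum by (simp add: quotient_gmodule_def with_act_def quotient_module_def)
  show "a \<odot>\<^bsub>quotient_gmodule V N\<^esub> (N +>\<^bsub>V\<^esub> x) = N +>\<^bsub>V\<^esub> (a \<odot>\<^bsub>V\<^esub> x)"
    if "a \<in> carrier K" "x \<in> carrier V" for a x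
    using smult_quotient_module[OF V.module_axioms N that]
    by (simp add: quotient_gmodule_def with_act_def)
  show "act (quotient_gmodule V N) g (N +>\<^bsub>V\<^esub> x) = N +>\<^bsub>V\<^esub> act V g x"
    if "g \<in> carrier G" "x \<in> carrier V" for g x
    using that
    by (simp add: quotient_gmodule_def with_act_def Union_cosets[OF A.abelian_subgroup_axioms] act_closed act_add inv)
qed (simp_all add: quotient_gmodule_def with_act_def coset_in_quotient, simp add: quotient_module_def)

lemma restrict_eq_iff: "restrict f A = restrict g A \<longleftrightarrow> (\<forall>x\<in>A. f x = g x)"
  by (metis restrict_apply' restrict_ext)

text \<open>The assumption \<open>ex1_primitive\<close> is the interface between the two halves:
  existence is the vanishing of every cocycle class of \<open>G\<close> on restriction to
  \<open>H\<close>, and uniqueness encodes that \<open>H\<close> has no nonzero fixed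
  vector.\<close>

locale coset_H1 = group_module G K V + H: subgroup H G
  for G :: "('g, 'x) monoid_scheme" and K :: "('a, 'y) ring_scheme"
    and V :: "('a, 'b, 'g, 'z) gmodule_scheme" and H +
  assumes field: "field K" and findim: "finite_dimensional K V"
    and ex1_primitive: "\<delta> \<in> cocycles G V \<Longrightarrow>
      \<exists>!v. v \<in> carrier V \<and> (\<forall>h\<in>H. \<delta> h = act V h v \<ominus>\<^bsub>V\<^esub> v)"
begin

section \<open>The permutation module and its quotient by the constants\<close>

abbreviation "L \<equiv> coset_gmodule G K H"
abbreviation "k \<equiv> fixed_points (carrier G) L"
abbreviation "Q \<equiv> quotient_gmodule L k"
abbreviation "V' \<equiv> dual_gmodule G K V"

lemma group_module_L: "group_module G K L"
  by (rule group_module_coset) (fact G.group_axioms V.R.is_cring H.subgroup_axioms)+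

sublocale L: group_module G K L by (rule group_module_L)

lemma submodule_k: "submodule k K L"
  by (rule submodule_fixed_points) (auto simp: group_module_L)

lemma act_k: "\<lbrakk>g \<in> carrier G; \<phi> \<in> k\<rbrakk> \<Longrightarrow> act L g \<phi> \<in> k"
  by (auto simp: fixed_points_def)

sublocale k: abelian_subgroup k L
  by (rule submodule_abelian_subgroup) (fact L.V.module_axioms submodule_k)+

sublocale Q: group_module G K Q
  by (rule group_module_quotient) (fact group_module_L submodule_k act_k)+

sublocale V': group_module G K V'
  by (rule group_module_dual) (rule group_module_axioms)

lemmas Q_simps = quotient_gmodule_simps[OF group_module_L submodule_k act_k]

lemma coset_mem: "g \<in> carrier G \<Longrightarrow> g <#\<^bsub>G\<^esub> H \<in> lcosets\<^bsub>G\<^esub> H"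
  by (auto simp: LCOSETS_def)

lemma one_coset: "\<one>\<^bsub>G\<^esub> <#\<^bsub>G\<^esub> H = H"
  by (rule G.lcos_mult_one) (rule H.subset)

lemma carrier_L: "carrier L = lcosets\<^bsub>G\<^esub> H \<rightarrow>\<^sub>E carrier K"
  by (simp add: coset_gmodule_def with_act_def fun_module_def)

lemma L_closed: "\<lbrakk>\<phi> \<in> carrier L; g \<in> carrier G\<rbrakk> \<Longrightarrow> \<phi> (g <#\<^bsub>G\<^esub> H) \<in> carrier K"
  using coset_mem by (auto simp: carrier_L)

lemma add_L: "g \<in> carrier G \<Longrightarrow> (\<phi> \<oplus>\<^bsub>L\<^esub> \<psi>) (g <#\<^bsub>G\<^esub> H) = \<phi> (g <#\<^bsub>G\<^esub> H) \<oplus>\<^bsub>K\<^esub> \<psi> (g <#\<^bsub>G\<^esub> H)"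
  using coset_mem by (simp add: coset_gmodule_def with_act_def fun_module_def base_module_def)

lemma smult_L: "g \<in> carrier G \<Longrightarrow> (a \<odot>\<^bsub>L\<^esub> \<phi>) (g <#\<^bsub>G\<^esub> H) = a \<otimes>\<^bsub>K\<^esub> \<phi> (g <#\<^bsub>G\<^esub> H)"
  using coset_mem by (simp add: coset_gmodule_def with_act_def fun_module_def base_module_def)

lemma act_L:
  "\<lbrakk>x \<in> carrier G; g \<in> carrier G\<rbrakk> \<Longrightarrow> act L x \<phi> (g <#\<^bsub>G\<^esub> H) = \<phi> ((inv\<^bsub>G\<^esub> x \<otimes>\<^bsub>G\<^esub> g) <#\<^bsub>G\<^esub> H)"
  using coset_mem by (simp add: coset_gmodule_def with_act_def G.lcos_m_assoc H.subset)

lemma L_eqI: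
  assumes "\<phi> \<in> carrier L" "\<psi> \<in> carrier L"
    and "\<And>g. g \<in> carrier G \<Longrightarrow> \<phi> (g <#\<^bsub>G\<^esub> H) = \<psi> (g <#\<^bsub>G\<^esub> H)"
  shows "\<phi> = \<psi>"
  using assms by (intro PiE_ext[of \<phi> "lcosets\<^bsub>G\<^esub> H" "\<lambda>_. carrier K" \<psi>]) (auto simp: carrier_L LCOSETS_def)

lemma k_eq: "k = {\<lambda>C\<in>lcosets\<^bsub>G\<^esub> H. a | a. a \<in> carrier K}"
  by (rule fixed_points_coset_gmodule) (fact G.group_axioms H.subgroup_axioms)+

lemma k_coset_eqI:
  assumes \<phi>: "\<phi> \<in> carrier L" and \<psi>: "\<psi> \<in> carrier L" and a: "a \<in> carrier K"
    and eq: "\<And>g. g \<in> carrier G \<Longrightarrow> \<phi> (g <#\<^bsub>G\<^esub> H) = a \<oplus>\<^bsub>K\<^esub> \<psi> (g <#\<^bsub>G\<^esub> H)"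
  shows "k +>\<^bsub>L\<^esub> \<phi> = k +>\<^bsub>L\<^esub> \<psi>"
proof -
  let ?a = "\<lambda>C\<in>lcosets\<^bsub>G\<^esub> H. a"
  have a': "?a \<in> k" using a by (auto simp: k_eq)
  have "?a \<in> carrier L" using a by (simp add: carrier_L)
  then have "\<phi> = ?a \<oplus>\<^bsub>L\<^esub> \<psi>" using \<phi> \<psi> by (intro L_eqI) (auto simp: add_L coset_mem eq)
  then show ?thesis using coset_eqI[OF k.abelian_subgroup_axioms \<psi> a'] by simp
qed

lemma k_coset_eqD:
  assumes "\<phi> \<in> carrier L" and "k +>\<^bsub>L\<^esub> \<phi> = k +>\<^bsub>L\<^esub> \<psi>"
  shows "\<exists>a\<in>carrier K. \<forall>g\<in>carrier G. \<phi> (g <#\<^bsub>G\<^esub> H) = a \<oplus>\<^bsub>K\<^esub> \<psi> (g <#\<^bsub>G\<^esub> H)"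
  using coset_eqD[OF k.abelian_subgroup_axioms assms] by (auto simp: k_eq add_L coset_mem)

text \<open>The two functions differ by a constant, which is read off at the coset \<open>H\<close>.
  Vanishing there thus singles out one representative of a class modulo \<open>k\<close>, compatibly
  with the linear structure but not with the action.\<close>

lemma normalized_unique:
  assumes \<phi>: "\<phi> \<in> carrier L" "\<phi> H = \<zero>\<^bsub>K\<^esub>" and \<psi>: "\<psi> \<in> carrier L" "\<psi> H = \<zero>\<^bsub>K\<^esub>"
    and eq: "k +>\<^bsub>L\<^esub> \<phi> = k +>\<^bsub>L\<^esub> \<psi>"
  shows "\<phi> = \<psi>"
proof -
  obtain a where a: "a \<in> carrier K" "\<And>g. g \<in> carrier G \<Longrightarrow> \<phi> (g <#\<^bsub>G\<^esub> H) = a \<oplus>\<^bsub>K\<^esub> \<psi> (g <#\<^bsub>G\<^esub> H)"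
    using k_coset_eqD[OF \<phi>(1) eq] by blast
  have "a = \<zero>\<^bsub>K\<^esub>" using a(2)[OF G.one_closed] a(1) \<phi>(2) \<psi>(2) by (simp add: one_coset)
  then show ?thesis using a \<phi> \<psi> L_closed by (intro L_eqI) auto
qed

section \<open>Linear forms on the module\<close>

lemma carrier_V': "carrier V' = linear_maps K V (base_module K)"
  by (simp add: dual_gmodule_def with_act_def)

lemma V'_closed: "\<lbrakk>f \<in> carrier V'; v \<in> carrier V\<rbrakk> \<Longrightarrow> f v \<in> carrier K"
  by (auto simp: carrier_V' dest: linear_map_closed)

lemma V'_add: "\<lbrakk>f \<in> carrier V'; v \<in> carrier V; w \<in> carrier V\<rbrakk> \<Longrightarrow> f (v \<oplus>\<^bsub>V\<^esub> w) = f v \<oplus>\<^bsub>K\<^esub> f w"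
  by (auto simp: carrier_V' linear_maps_def base_module_def)

lemma V'_smult: "\<lbrakk>f \<in> carrier V'; a \<in> carrier K; v \<in> carrier V\<rbrakk> \<Longrightarrow> f (a \<odot>\<^bsub>V\<^esub> v) = a \<otimes>\<^bsub>K\<^esub> f v"
  by (auto simp: carrier_V' linear_maps_def base_module_def)

lemma V'_zero: "f \<in> carrier V' \<Longrightarrow> f \<zero>\<^bsub>V\<^esub> = \<zero>\<^bsub>K\<^esub>"
  using V'_smult[of f "\<zero>\<^bsub>K\<^esub>" "\<zero>\<^bsub>V\<^esub>"] V'_closed by simp

lemma add_V': "v \<in> carrier V \<Longrightarrow> (f \<oplus>\<^bsub>V'\<^esub> g) v = f v \<oplus>\<^bsub>K\<^esub> g v"
  by (simp add: dual_gmodule_def with_act_def fun_module_def base_module_def)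

lemma smult_V': "v \<in> carrier V \<Longrightarrow> (a \<odot>\<^bsub>V'\<^esub> f) v = a \<otimes>\<^bsub>K\<^esub> f v"
  by (simp add: dual_gmodule_def with_act_def fun_module_def base_module_def)

lemma act_V': "v \<in> carrier V \<Longrightarrow> act V' x f v = f (act V (inv\<^bsub>G\<^esub> x) v)"
  by (simp add: dual_gmodule_def with_act_def)

lemma V'_separates:
  "\<lbrakk>v \<in> carrier V; w \<in> carrier V; \<And>f. f \<in> carrier V' \<Longrightarrow> f v = f w\<rbrakk> \<Longrightarrow> v = w"
  using linear_functionals_separate[OF V.module_axioms field findim] by (simp add: carrier_V')

section \<open>Cocycles and their primitives on the subgroup\<close>

abbreviation "C1 \<equiv> fun_module (carrier G) V"
abbreviation "Z \<equiv> C1\<lparr>carrier := cocycles G V\<rparr>"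

lemma module_Z: "module K Z"
  by (intro submodule_module module_fun_module module_H1) (fact V.module_axioms group_module_axioms)+

sublocale Z: module K Z by (rule module_Z)

lemma add_Z: "g \<in> carrier G \<Longrightarrow> (\<delta> \<oplus>\<^bsub>C1\<^esub> \<epsilon>) g = \<delta> g \<oplus>\<^bsub>V\<^esub> \<epsilon> g"
  by (simp add: fun_module_def)

lemma smult_Z: "g \<in> carrier G \<Longrightarrow> (a \<odot>\<^bsub>C1\<^esub> \<delta>) g = a \<odot>\<^bsub>V\<^esub> \<delta> g"
  by (simp add: fun_module_def)

text \<open>The uniqueness behind \<open>THE\<close> is what makes the primitive depend linearly on
  the cocycle; an arbitrary choice would not.\<close>

definition primitive :: "('g \<Rightarrow> 'b) \<Rightarrow> 'b"
  where "primitive \<delta> = (THE v. v \<in> carrier V \<and> (\<forall>h\<in>H. \<delta> h = act V h v \<ominus>\<^bsub>V\<^esub> v))"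

lemma primitive:
  assumes "\<delta> \<in> cocycles G V"
  shows primitive_closed: "primitive \<delta> \<in> carrier V"
    and primitive_eq: "\<And>h. h \<in> H \<Longrightarrow> \<delta> h = act V h (primitive \<delta>) \<ominus>\<^bsub>V\<^esub> primitive \<delta>"
  using theI'[OF ex1_primitive[OF assms]] unfolding primitive_def by blast+

lemma primitive_unique:
  "\<lbrakk>\<delta> \<in> cocycles G V; v \<in> carrier V; \<And>h. h \<in> H \<Longrightarrow> \<delta> h = act V h v \<ominus>\<^bsub>V\<^esub> v\<rbrakk> \<Longrightarrow> primitive \<delta> = v"
  using ex1_primitive[of \<delta>] primitive[of \<delta>] by blast

lemma primitive_add:
  assumes \<delta>: "\<delta> \<in> cocycles G V" and \<epsilon>: "\<epsilon> \<in> cocycles G V"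
  shows "primitive (\<delta> \<oplus>\<^bsub>C1\<^esub> \<epsilon>) = primitive \<delta> \<oplus>\<^bsub>V\<^esub> primitive \<epsilon>"
proof (rule primitive_unique)
  note [simp] = primitive_closed[OF \<delta>] primitive_closed[OF \<epsilon>]
  fix h assume h: "h \<in> H"
  then show "(\<delta> \<oplus>\<^bsub>C1\<^esub> \<epsilon>) h = act V h (primitive \<delta> \<oplus>\<^bsub>V\<^esub> primitive \<epsilon>) \<ominus>\<^bsub>V\<^esub> (primitive \<delta> \<oplus>\<^bsub>V\<^esub> primitive \<epsilon>)"
    using primitive_eq[OF \<delta> h] primitive_eq[OF \<epsilon> h]
    by (simp add: add_Z act_add act_closed a_minus_def V.M.minus_add V.M.a_ac)
qed (use Z.a_closed[of \<delta> \<epsilon>] \<delta> \<epsilon> primitive_closed in auto)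

lemma primitive_smult:
  assumes \<delta>: "\<delta> \<in> cocycles G V" and a: "a \<in> carrier K"
  shows "primitive (a \<odot>\<^bsub>C1\<^esub> \<delta>) = a \<odot>\<^bsub>V\<^esub> primitive \<delta>"
proof (rule primitive_unique)
  note [simp] = primitive_closed[OF \<delta>]
  fix h assume h: "h \<in> H"
  then show "(a \<odot>\<^bsub>C1\<^esub> \<delta>) h = act V h (a \<odot>\<^bsub>V\<^esub> primitive \<delta>) \<ominus>\<^bsub>V\<^esub> a \<odot>\<^bsub>V\<^esub> primitive \<delta>"
    using primitive_eq[OF \<delta> h] a
    by (simp add: smult_Z act_smult act_closed a_minus_def V.smult_r_distr V.smult_r_minus)
qed (use Z.smult_closed[of a \<delta>] \<delta> a primitive_closed in auto)

text \<open>
  Up to the constant \<open>- primitive \<delta>\<close>, this is the cocycle cohomologous to \<open>\<delta>\<close> that vanishes on \<open>H\<close>.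
\<close>

definition normal_form :: "('g \<Rightarrow> 'b) \<Rightarrow> 'g \<Rightarrow> 'b"
  where "normal_form \<delta> g = \<delta> g \<ominus>\<^bsub>V\<^esub> act V g (primitive \<delta>)"

lemma normal_form_closed: "\<lbrakk>\<delta> \<in> cocycles G V; g \<in> carrier G\<rbrakk> \<Longrightarrow> normal_form \<delta> g \<in> carrier V"
  by (simp add: normal_form_def cocycle_closed act_closed primitive_closed)

text \<open>Left translation by \<open>x\<close> acts affinely on the values: the linear part is the
  action of \<open>x\<close>, and the translation part \<open>\<delta> x\<close> does not depend on
  \<open>g\<close>. The latter is what dies modulo constants.\<close>

lemma normal_form_mult:
  "\<lbrakk>\<delta> \<in> cocycles G V; x \<in> carrier G; g \<in> carrier G\<rbrakk>
    \<Longrightarrow> normal_form \<delta> (x \<otimes>\<^bsub>G\<^esub> g) = \<delta> x \<oplus>\<^bsub>V\<^esub> act V x (normal_form \<delta> g)"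
  by (simp add: normal_form_def cocycle_mult act_mult a_minus_def act_add act_minus act_closed
      cocycle_closed primitive_closed V.M.a_assoc)

text \<open>On \<open>H\<close> the normal form is constantly minus the primitive, so multiplying by
  \<open>h\<close> on the right gives the same value as multiplying by one. Hence the normal form
  descends to left cosets.\<close>

lemma normal_form_mult_H:
  assumes \<delta>: "\<delta> \<in> cocycles G V" and g: "g \<in> carrier G" and h: "h \<in> H"
  shows "normal_form \<delta> (g \<otimes>\<^bsub>G\<^esub> h) = normal_form \<delta> g"
proof -
  have "normal_form \<delta> h = \<ominus>\<^bsub>V\<^esub> primitive \<delta>"
    using primitive_closed[OF \<delta>] h
    by (simp add: normal_form_def primitive_eq[OF \<delta> h] a_minus_def act_closed V.M.a_ac V.M.r_neg1 V.M.r_neg)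
  then show ?thesis
    using normal_form_mult[OF \<delta> g, of h] h g primitive_closed[OF \<delta>]
    by (simp add: act_minus normal_form_def a_minus_def)
qed

lemma normal_form_add:
  assumes "\<delta> \<in> cocycles G V" and "\<epsilon> \<in> cocycles G V" and "g \<in> carrier G"
  shows "normal_form (\<delta> \<oplus>\<^bsub>C1\<^esub> \<epsilon>) g = normal_form \<delta> g \<oplus>\<^bsub>V\<^esub> normal_form \<epsilon> g"
  using assms
  by (simp add: normal_form_def add_Z primitive_add act_add act_closed cocycle_closed
      primitive_closed a_minus_def V.M.minus_add V.M.a_ac)

lemma normal_form_smult:
  assumes "\<delta> \<in> cocycles G V" and "a \<in> carrier K" and "g \<in> carrier G"
  shows "normal_form (a \<odot>\<^bsub>C1\<^esub> \<delta>) g = a \<odot>\<^bsub>V\<^esub> normal_form \<delta> g"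
  using assms
  by (simp add: normal_form_def smult_Z primitive_smult act_smult act_closed cocycle_closed
      primitive_closed a_minus_def V.smult_r_distr V.smult_r_minus)

section \<open>From cocycles to equivariant maps modulo constants\<close>

definition lift :: "('g \<Rightarrow> 'b) \<Rightarrow> ('b \<Rightarrow> 'a) \<Rightarrow> 'g set \<Rightarrow> 'a"
  where "lift \<delta> f = (\<lambda>C\<in>lcosets\<^bsub>G\<^esub> H. f (normal_form \<delta> (SOME g. g \<in> C)))"

lemma lift_coset:
  assumes "\<delta> \<in> cocycles G V" and g: "g \<in> carrier G"
  shows "lift \<delta> f (g <#\<^bsub>G\<^esub> H) = f (normal_form \<delta> g)"
proof -
  have "g \<in> g <#\<^bsub>G\<^esub> H" using G.lcos_self[OF g H.subgroup_axioms] .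
  then have "(SOME x. x \<in> g <#\<^bsub>G\<^esub> H) \<in> g <#\<^bsub>G\<^esub> H" by (rule someI)
  then obtain h where "h \<in> H" "(SOME x. x \<in> g <#\<^bsub>G\<^esub> H) = g \<otimes>\<^bsub>G\<^esub> h" by (auto simp: l_coset_def)
  then show ?thesis using normal_form_mult_H[OF assms] coset_mem[OF g] by (simp add: lift_def)
qed

lemma lift_closed:
  assumes \<delta>: "\<delta> \<in> cocycles G V" and f: "f \<in> carrier V'"
  shows "lift \<delta> f \<in> carrier L"
proof -
  have "lift \<delta> f C \<in> carrier K" if "C \<in> lcosets\<^bsub>G\<^esub> H" for C
    using that lift_coset[OF \<delta>] V'_closed[OF f] normal_form_closed[OF \<delta>] by (auto simp: LCOSETS_def)
  then show ?thesis by (auto simp: carrier_L PiE_iff) (simp add: lift_def)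
qed

lemma lift_add:
  assumes "\<delta> \<in> cocycles G V" and "\<epsilon> \<in> cocycles G V" and "f \<in> carrier V'"
  shows "lift (\<delta> \<oplus>\<^bsub>C1\<^esub> \<epsilon>) f = lift \<delta> f \<oplus>\<^bsub>L\<^esub> lift \<epsilon> f"
  using assms Z.a_closed[of \<delta> \<epsilon>]
  by (intro L_eqI) (simp_all add: lift_closed lift_coset add_L normal_form_add V'_add normal_form_closed)

lemma lift_smult:
  assumes "\<delta> \<in> cocycles G V" and "a \<in> carrier K" and "f \<in> carrier V'"
  shows "lift (a \<odot>\<^bsub>C1\<^esub> \<delta>) f = a \<odot>\<^bsub>L\<^esub> lift \<delta> f"
  using assms Z.smult_closed[of a \<delta>]
  by (intro L_eqI) (simp_all add: lift_closed lift_coset smult_L normal_form_smult V'_smult normal_form_closed)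

lemma lift_add_dual:
  assumes "\<delta> \<in> cocycles G V" and "f \<in> carrier V'" and "g \<in> carrier V'"
  shows "lift \<delta> (f \<oplus>\<^bsub>V'\<^esub> g) = lift \<delta> f \<oplus>\<^bsub>L\<^esub> lift \<delta> g"
  using assms
  by (intro L_eqI) (simp_all add: lift_closed lift_coset add_L add_V' normal_form_closed)

lemma lift_smult_dual:
  assumes "\<delta> \<in> cocycles G V" and "a \<in> carrier K" and "f \<in> carrier V'"
  shows "lift \<delta> (a \<odot>\<^bsub>V'\<^esub> f) = a \<odot>\<^bsub>L\<^esub> lift \<delta> f"
  using assms
  by (intro L_eqI) (simp_all add: lift_closed lift_coset smult_L smult_V' normal_form_closed)

text \<open>The two functions differ by the constant \<open>f (\<delta> (inv x))\<close>: the action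
  on \<open>L\<close> translates arguments by \<open>inv x\<close>, and
  \<open>normal_form_mult\<close> splits off \<open>\<delta> (inv x)\<close>.\<close>

lemma lift_act_dual:
  assumes \<delta>: "\<delta> \<in> cocycles G V" and x: "x \<in> carrier G" and f: "f \<in> carrier V'"
  shows "k +>\<^bsub>L\<^esub> lift \<delta> (act V' x f) = k +>\<^bsub>L\<^esub> act L x (lift \<delta> f)"
proof (rule sym, rule k_coset_eqI)
  fix g assume g: "g \<in> carrier G"
  show "act L x (lift \<delta> f) (g <#\<^bsub>G\<^esub> H) = f (\<delta> (inv\<^bsub>G\<^esub> x)) \<oplus>\<^bsub>K\<^esub> lift \<delta> (act V' x f) (g <#\<^bsub>G\<^esub> H)"
    using assms g
    by (simp add: act_L lift_coset normal_form_mult V'_add cocycle_closed act_closed normal_form_closed act_V')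
qed (use assms lift_closed L.act_closed V'.act_closed V'_closed cocycle_closed in auto)

definition coset_map :: "('g \<Rightarrow> 'b) \<Rightarrow> ('b \<Rightarrow> 'a) \<Rightarrow> ('g set \<Rightarrow> 'a) set"
  where "coset_map \<delta> = (\<lambda>f\<in>carrier V'. k +>\<^bsub>L\<^esub> lift \<delta> f)"

abbreviation "W \<equiv> Hom_module G K V' Q"

lemma carrier_W: "F \<in> carrier W \<longleftrightarrow> F \<in> carrier V' \<rightarrow>\<^sub>E carrier Q \<and>
    (\<forall>f\<in>carrier V'. \<forall>g\<in>carrier V'. F (f \<oplus>\<^bsub>V'\<^esub> g) = F f \<oplus>\<^bsub>Q\<^esub> F g) \<and>
    (\<forall>a\<in>carrier K. \<forall>f\<in>carrier V'. F (a \<odot>\<^bsub>V'\<^esub> f) = a \<odot>\<^bsub>Q\<^esub> F f) \<and>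
    (\<forall>x\<in>carrier G. \<forall>f\<in>carrier V'. F (act V' x f) = act Q x (F f))"
  by (simp add: Hom_module_def linear_maps_def)

lemma add_W: "F \<oplus>\<^bsub>W\<^esub> F' = (\<lambda>f\<in>carrier V'. F f \<oplus>\<^bsub>Q\<^esub> F' f)"
  by (simp add: Hom_module_def fun_module_def)

lemma smult_W: "a \<odot>\<^bsub>W\<^esub> F = (\<lambda>f\<in>carrier V'. a \<odot>\<^bsub>Q\<^esub> F f)"
  by (simp add: Hom_module_def fun_module_def)

lemma coset_map_closed:
  assumes \<delta>: "\<delta> \<in> cocycles G V"
  shows "coset_map \<delta> \<in> carrier W"
proof -
  have "k +>\<^bsub>L\<^esub> lift \<delta> f \<in> carrier Q" if "f \<in> carrier V'" for f
    using lift_closed[OF \<delta> that] Q_simps(4) by blast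
  then show ?thesis
    unfolding carrier_W using \<delta> lift_closed
    by (simp add: coset_map_def Q_simps(1-3) lift_add_dual lift_smult_dual lift_act_dual V'.act_closed)
qed

lemma coset_map_add:
  assumes "\<delta> \<in> cocycles G V" and "\<epsilon> \<in> cocycles G V"
  shows "coset_map (\<delta> \<oplus>\<^bsub>C1\<^esub> \<epsilon>) = coset_map \<delta> \<oplus>\<^bsub>W\<^esub> coset_map \<epsilon>"
  using assms lift_closed
  by (simp add: coset_map_def add_W lift_add Q_simps(1-3) cong: restrict_cong)

lemma coset_map_smult:
  assumes "\<delta> \<in> cocycles G V" and "a \<in> carrier K"
  shows "coset_map (a \<odot>\<^bsub>C1\<^esub> \<delta>) = a \<odot>\<^bsub>W\<^esub> coset_map \<delta>"
  using assms lift_closed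
  by (simp add: coset_map_def smult_W lift_smult Q_simps(1-3) cong: restrict_cong)

text \<open>The image vanishes when all lifts are constant. Since linear forms separate vectors, the
  normal form is then constant, equal to its value at one, minus the primitive; this says that
  \<open>\<delta>\<close> is the coboundary of its primitive.\<close>

lemma coset_map_eq_zero_iff:
  assumes \<delta>: "\<delta> \<in> cocycles G V"
  shows "coset_map \<delta> = \<zero>\<^bsub>W\<^esub> \<longleftrightarrow> \<delta> \<in> coboundaries G V"
proof -
  let ?v = "primitive \<delta>"
  have v: "?v \<in> carrier V" using primitive_closed[OF \<delta>] .
  have n1: "normal_form \<delta> \<one>\<^bsub>G\<^esub> = \<ominus>\<^bsub>V\<^esub> ?v"
    using v primitive_eq[OF \<delta> H.one_closed] by (simp add: normal_form_def act_one a_minus_def V.M.r_neg)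
  have z: "\<zero>\<^bsub>L\<^esub> (g <#\<^bsub>G\<^esub> H) = \<zero>\<^bsub>K\<^esub>" if "g \<in> carrier G" for g
    using that smult_L[of g "\<zero>\<^bsub>K\<^esub>" "\<zero>\<^bsub>L\<^esub>"] L_closed[of "\<zero>\<^bsub>L\<^esub>" g] by simp
  have "\<zero>\<^bsub>W\<^esub> = (\<lambda>f\<in>carrier V'. k +>\<^bsub>L\<^esub> \<zero>\<^bsub>L\<^esub>)"
    using k.a_subset by (simp add: Hom_module_def fun_module_def Q_simps)
  then have zero_iff: "coset_map \<delta> = \<zero>\<^bsub>W\<^esub> \<longleftrightarrow> (\<forall>f\<in>carrier V'. k +>\<^bsub>L\<^esub> lift \<delta> f = k +>\<^bsub>L\<^esub> \<zero>\<^bsub>L\<^esub>)"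
    by (simp only: coset_map_def restrict_eq_iff)
  show ?thesis
  proof
    assume "coset_map \<delta> = \<zero>\<^bsub>W\<^esub>"
    then have eq: "k +>\<^bsub>L\<^esub> lift \<delta> f = k +>\<^bsub>L\<^esub> \<zero>\<^bsub>L\<^esub>" if "f \<in> carrier V'" for f
      using that zero_iff by blast
    have "\<delta> g = act V g ?v \<ominus>\<^bsub>V\<^esub> ?v" if g: "g \<in> carrier G" for g
    proof -
      have "normal_form \<delta> g = normal_form \<delta> \<one>\<^bsub>G\<^esub>"
      proof (rule V'_separates)
        fix f assume f: "f \<in> carrier V'"
        obtain a where a: "a \<in> carrier K"
          "\<And>g. g \<in> carrier G \<Longrightarrow> lift \<delta> f (g <#\<^bsub>G\<^esub> H) = a \<oplus>\<^bsub>K\<^esub> \<zero>\<^bsub>L\<^esub> (g <#\<^bsub>G\<^esub> H)"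
          using k_coset_eqD[OF lift_closed[OF \<delta> f] eq[OF f]] by blast
        have "f (normal_form \<delta> g) = a" if "g \<in> carrier G" for g
          using a(2)[OF that] lift_coset[OF \<delta> that] z[OF that] a(1) by simp
        then show "f (normal_form \<delta> g) = f (normal_form \<delta> \<one>\<^bsub>G\<^esub>)" using g by simp
      qed (use normal_form_closed[OF \<delta>] g in auto)
      then have "\<delta> g \<ominus>\<^bsub>V\<^esub> act V g ?v = \<ominus>\<^bsub>V\<^esub> ?v" unfolding n1 by (simp only: normal_form_def)
      then have "\<delta> g = \<ominus>\<^bsub>V\<^esub> ?v \<oplus>\<^bsub>V\<^esub> act V g ?v"
        using V.M.minus_eq_iff[of "\<delta> g" "act V g ?v" "\<ominus>\<^bsub>V\<^esub> ?v"] g v cocycle_closed[OF \<delta> g]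
        by (simp add: act_closed)
      then show ?thesis using g v by (simp add: a_minus_def V.M.a_comm act_closed)
    qed
    then have "\<delta> = (\<lambda>g\<in>carrier G. act V g ?v \<ominus>\<^bsub>V\<^esub> ?v)"
      using \<delta> by (auto simp: cocycles_def PiE_iff extensional_def fun_eq_iff)
    then show "\<delta> \<in> coboundaries G V" using v unfolding coboundaries_def by blast
  next
    assume "\<delta> \<in> coboundaries G V"
    then obtain w where w: "w \<in> carrier V" "\<delta> = (\<lambda>g\<in>carrier G. act V g w \<ominus>\<^bsub>V\<^esub> w)"
      unfolding coboundaries_def by blast
    \<comment> \<open>By uniqueness the primitive of the coboundary of \<open>w\<close> is
      \<open>w\<close>, and so the normal form is constantly minus \<open>w\<close>.\<close>
    then have pw: "?v = w" by (intro primitive_unique[OF \<delta>]) auto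
    have nf: "normal_form \<delta> g = \<ominus>\<^bsub>V\<^esub> w" if "g \<in> carrier G" for g
      unfolding normal_form_def pw
      using that w by (simp add: a_minus_def act_closed V.M.a_ac V.M.r_neg1 V.M.r_neg)
    have "k +>\<^bsub>L\<^esub> lift \<delta> f = k +>\<^bsub>L\<^esub> \<zero>\<^bsub>L\<^esub>" if f: "f \<in> carrier V'" for f
      using lift_closed[OF \<delta> f] w(1) V'_closed[OF f]
      by (intro k_coset_eqI[where a = "f (\<ominus>\<^bsub>V\<^esub> w)"]) (auto simp: lift_coset[OF \<delta>] nf z)
    then show "coset_map \<delta> = \<zero>\<^bsub>W\<^esub>" using zero_iff by blast
  qed
qed

text \<open>
  Each \<open>F f\<close> has a unique representative \<open>p f\<close> vanishing at the coset \<open>H\<close>; by reflexivity of \<open>V\<close>, the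
  functional \<open>f \<mapsto> p f (g H)\<close> is evaluation at a vector, which is the value at \<open>g\<close> of the wanted cocycle.
\<close>

lemma coset_map_surj:
  assumes "F \<in> carrier W"
  shows "\<exists>\<delta>\<in>cocycles G V. coset_map \<delta> = F"
proof -
  have FQ: "F \<in> carrier V' \<rightarrow>\<^sub>E carrier Q"
    and F_add: "\<And>f g. \<lbrakk>f \<in> carrier V'; g \<in> carrier V'\<rbrakk> \<Longrightarrow> F (f \<oplus>\<^bsub>V'\<^esub> g) = F f \<oplus>\<^bsub>Q\<^esub> F g"
    and F_smult: "\<And>a f. \<lbrakk>a \<in> carrier K; f \<in> carrier V'\<rbrakk> \<Longrightarrow> F (a \<odot>\<^bsub>V'\<^esub> f) = a \<odot>\<^bsub>Q\<^esub> F f"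
    and F_act: "\<And>x f. \<lbrakk>x \<in> carrier G; f \<in> carrier V'\<rbrakk> \<Longrightarrow> F (act V' x f) = act Q x (F f)"
    using assms unfolding carrier_W by blast+
  have normalize: "\<exists>\<psi>\<in>carrier L. k +>\<^bsub>L\<^esub> \<psi> = k +>\<^bsub>L\<^esub> \<phi> \<and>
      (\<forall>g\<in>carrier G. \<psi> (g <#\<^bsub>G\<^esub> H) = \<phi> (g <#\<^bsub>G\<^esub> H) \<ominus>\<^bsub>K\<^esub> \<phi> H)" if \<phi>: "\<phi> \<in> carrier L" for \<phi>
  proof -
    have H: "\<phi> H \<in> carrier K" using L_closed[OF \<phi> G.one_closed] by (simp add: one_coset)
    let ?\<psi> = "\<lambda>C\<in>lcosets\<^bsub>G\<^esub> H. \<phi> C \<ominus>\<^bsub>K\<^esub> \<phi> H"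
    have \<psi>: "?\<psi> \<in> carrier L" using \<phi> H by (auto simp: carrier_L)
    have val: "?\<psi> (g <#\<^bsub>G\<^esub> H) = \<phi> (g <#\<^bsub>G\<^esub> H) \<ominus>\<^bsub>K\<^esub> \<phi> H" if "g \<in> carrier G" for g
      using coset_mem[OF that] by simp
    have "k +>\<^bsub>L\<^esub> ?\<psi> = k +>\<^bsub>L\<^esub> \<phi>"
      using H L_closed[OF \<phi>]
      by (intro k_coset_eqI[OF \<psi> \<phi>, of "\<ominus>\<^bsub>K\<^esub> \<phi> H"]) (auto simp: coset_mem a_minus_def V.R.a_comm)
    then show ?thesis using \<psi> val by blast
  qed
  have "\<exists>\<phi>. \<phi> \<in> carrier L \<and> \<phi> H = \<zero>\<^bsub>K\<^esub> \<and> F f = k +>\<^bsub>L\<^esub> \<phi>" if f: "f \<in> carrier V'" for f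
  proof -
    have "F f \<in> carrier Q" using FQ f by blast
    then obtain \<phi> where \<phi>: "\<phi> \<in> carrier L" "F f = k +>\<^bsub>L\<^esub> \<phi>" by (auto simp: Q_simps)
    obtain \<psi> where \<psi>: "\<psi> \<in> carrier L" "k +>\<^bsub>L\<^esub> \<psi> = k +>\<^bsub>L\<^esub> \<phi>"
      "\<And>g. g \<in> carrier G \<Longrightarrow> \<psi> (g <#\<^bsub>G\<^esub> H) = \<phi> (g <#\<^bsub>G\<^esub> H) \<ominus>\<^bsub>K\<^esub> \<phi> H"
      using normalize[OF \<phi>(1)] by blast
    have "\<psi> H = \<zero>\<^bsub>K\<^esub>"
      using \<psi>(3)[OF G.one_closed] L_closed[OF \<phi>(1) G.one_closed]
      by (simp add: one_coset a_minus_def V.R.r_neg)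
    then show ?thesis using \<psi> \<phi>(2) by metis
  qed
  then obtain p where p: "\<And>f. f \<in> carrier V' \<Longrightarrow> p f \<in> carrier L"
    and pH: "\<And>f. f \<in> carrier V' \<Longrightarrow> p f H = \<zero>\<^bsub>K\<^esub>"
    and Fp: "\<And>f. f \<in> carrier V' \<Longrightarrow> F f = k +>\<^bsub>L\<^esub> p f"
    by metis
  \<comment> \<open>Linearity of \<open>p\<close> and its behaviour under the action are all derived
    from this criterion, by exhibiting another normalized representative.\<close>
  have p_eqI: "p f = \<phi>" if "f \<in> carrier V'" "\<phi> \<in> carrier L" "\<phi> H = \<zero>\<^bsub>K\<^esub>" "F f = k +>\<^bsub>L\<^esub> \<phi>" for f \<phi>
    using that by (intro normalized_unique) (auto simp: p pH Fp[symmetric])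
  have Fp_add: "F (f \<oplus>\<^bsub>V'\<^esub> g) = k +>\<^bsub>L\<^esub> (p f \<oplus>\<^bsub>L\<^esub> p g)" if "f \<in> carrier V'" "g \<in> carrier V'" for f g
    unfolding F_add[OF that] Fp[OF that(1)] Fp[OF that(2)] using that p by (simp add: Q_simps)
  have Fp_smult: "F (a \<odot>\<^bsub>V'\<^esub> f) = k +>\<^bsub>L\<^esub> (a \<odot>\<^bsub>L\<^esub> p f)" if "a \<in> carrier K" "f \<in> carrier V'" for a f
    unfolding F_smult[OF that] Fp[OF that(2)] using that p by (simp add: Q_simps)
  have p_add: "p (f \<oplus>\<^bsub>V'\<^esub> g) = p f \<oplus>\<^bsub>L\<^esub> p g" if "f \<in> carrier V'" "g \<in> carrier V'" for f g
    using that p pH add_L[OF G.one_closed, of "p f" "p g"]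
    by (intro p_eqI) (simp_all add: Fp_add one_coset)
  have p_smult: "p (a \<odot>\<^bsub>V'\<^esub> f) = a \<odot>\<^bsub>L\<^esub> p f" if "a \<in> carrier K" "f \<in> carrier V'" for a f
    using that p pH smult_L[OF G.one_closed, of a "p f"]
    by (intro p_eqI) (simp_all add: Fp_smult one_coset)
  \<comment> \<open>The translate of \<open>p f\<close> by \<open>x\<close> represents the right
    class but need not vanish at the coset \<open>H\<close>, so its value there is subtracted. This
    correction becomes the term \<open>d x\<close> of the cocycle identity.\<close>
  have p_act: "p (act V' x f) (g <#\<^bsub>G\<^esub> H)
      = p f ((inv\<^bsub>G\<^esub> x \<otimes>\<^bsub>G\<^esub> g) <#\<^bsub>G\<^esub> H) \<ominus>\<^bsub>K\<^esub> p f (inv\<^bsub>G\<^esub> x <#\<^bsub>G\<^esub> H)"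
    if x: "x \<in> carrier G" and f: "f \<in> carrier V'" and g: "g \<in> carrier G" for x f g
  proof -
    let ?\<phi> = "act L x (p f)"
    have \<phi>: "?\<phi> \<in> carrier L" using x p[OF f] by (rule L.act_closed)
    have \<phi>H: "?\<phi> H = p f (inv\<^bsub>G\<^esub> x <#\<^bsub>G\<^esub> H)"
      using act_L[OF x G.one_closed, of "p f"] x by (simp add: one_coset)
    obtain \<psi> where \<psi>: "\<psi> \<in> carrier L" "k +>\<^bsub>L\<^esub> \<psi> = k +>\<^bsub>L\<^esub> ?\<phi>"
      "\<And>g. g \<in> carrier G \<Longrightarrow> \<psi> (g <#\<^bsub>G\<^esub> H) = ?\<phi> (g <#\<^bsub>G\<^esub> H) \<ominus>\<^bsub>K\<^esub> ?\<phi> H"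
      using normalize[OF \<phi>] by blast
    have "\<psi> H = \<zero>\<^bsub>K\<^esub>"
      using \<psi>(3)[OF G.one_closed] L_closed[OF \<phi> G.one_closed]
      by (simp add: one_coset a_minus_def V.R.r_neg)
    moreover have "F (act V' x f) = k +>\<^bsub>L\<^esub> \<psi>"
      unfolding F_act[OF x f] Fp[OF f] using x p[OF f] \<psi>(2) by (simp add: Q_simps)
    ultimately have "p (act V' x f) = \<psi>" using x f \<psi>(1) V'.act_closed by (intro p_eqI)
    then show ?thesis using \<psi>(3)[OF g] x g by (simp add: act_L \<phi>H)
  qed
  have "\<exists>v. v \<in> carrier V \<and> (\<forall>f\<in>carrier V'. p f (g <#\<^bsub>G\<^esub> H) = f v)" if g: "g \<in> carrier G" for g
  proof -
    \<comment> \<open>The dual space stripped of its action, which is the form in which reflexivity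
      was proved.\<close>
    let ?D = "(fun_module (carrier V) (base_module K))\<lparr>carrier := linear_maps K V (base_module K)\<rparr>"
    have D: "carrier ?D = carrier V'" "add ?D = add V'" "smult ?D = smult V'"
      by (simp_all add: dual_gmodule_def with_act_def)
    have "(\<lambda>f\<in>carrier V'. p f (g <#\<^bsub>G\<^esub> H)) \<in> linear_maps K ?D (base_module K)"
      unfolding linear_maps_def[of K ?D] D
      using g p L_closed p_add p_smult add_L smult_L by (auto simp: base_module_def)
    from double_dual_evaluation[OF V.module_axioms field findim this]
    show ?thesis by (auto simp: carrier_V')
  qed
  then obtain d where d: "\<And>g. g \<in> carrier G \<Longrightarrow> d g \<in> carrier V"
    and pd: "\<And>g f. \<lbrakk>g \<in> carrier G; f \<in> carrier V'\<rbrakk> \<Longrightarrow> p f (g <#\<^bsub>G\<^esub> H) = f (d g)"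
    by metis
  have d_mult: "d (x \<otimes>\<^bsub>G\<^esub> g) = d x \<oplus>\<^bsub>V\<^esub> act V x (d g)" if x: "x \<in> carrier G" and g: "g \<in> carrier G" for x g
  proof (rule V'_separates)
    fix f assume f: "f \<in> carrier V'"
    \<comment> \<open>\<open>p_act\<close> is used at \<open>inv x\<close>, since the action on the
      dual already involves an inverse.\<close>
    have "f (act V x (d g)) = f (d (x \<otimes>\<^bsub>G\<^esub> g)) \<ominus>\<^bsub>K\<^esub> f (d x)"
      using p_act[OF _ f g, of "inv\<^bsub>G\<^esub> x"] x g f by (simp add: pd V'.act_closed act_V' d)
    then have "f (d (x \<otimes>\<^bsub>G\<^esub> g)) = f (act V x (d g)) \<oplus>\<^bsub>K\<^esub> f (d x)"
      using V.R.minus_eq_iff[of "f (d (x \<otimes>\<^bsub>G\<^esub> g))" "f (d x)" "f (act V x (d g))"] x g f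
      by (simp add: V'_closed d act_closed)
    then show "f (d (x \<otimes>\<^bsub>G\<^esub> g)) = f (d x \<oplus>\<^bsub>V\<^esub> act V x (d g))"
      using x g f by (simp add: V'_add V'_closed d act_closed V.R.a_comm)
  qed (use x g d act_closed in auto)
  have d_H: "d h = \<zero>\<^bsub>V\<^esub>" if h: "h \<in> H" for h
  proof (rule V'_separates)
    fix f assume f: "f \<in> carrier V'"
    have "h <#\<^bsub>G\<^esub> H = H" using G.coset_join3 h H.subgroup_axioms by auto
    then show "f (d h) = f \<zero>\<^bsub>V\<^esub>" using pd[of h f] h f pH[OF f] by (simp add: V'_zero)
  qed (use h d in auto)
  define \<delta> where "\<delta> = restrict d (carrier G)"
  have \<delta>: "\<delta> \<in> cocycles G V" using d d_mult by (auto simp: cocycles_def \<delta>_def)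
  \<comment> \<open>Normalization at the coset \<open>H\<close> makes \<open>d\<close> vanish on
    \<open>H\<close>; its primitive is therefore zero and its normal form is \<open>d\<close>
    itself, so that its lifts are the functions \<open>p f\<close>.\<close>
  have "primitive \<delta> = \<zero>\<^bsub>V\<^esub>"
    using d_H by (intro primitive_unique[OF \<delta>]) (auto simp: \<delta>_def act_zero a_minus_def V.M.r_neg)
  then have nf: "normal_form \<delta> g = d g" if "g \<in> carrier G" for g
    using that d by (simp add: normal_form_def act_zero \<delta>_def a_minus_def)
  have "lift \<delta> f = p f" if f: "f \<in> carrier V'" for f
    using f by (intro L_eqI) (auto simp: lift_closed[OF \<delta>] p lift_coset[OF \<delta>] nf pd)
  then have "coset_map \<delta> f = F f" if "f \<in> carrier V'" for f
    using that by (simp add: coset_map_def Fp)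
  then have "coset_map \<delta> = F"
    using FQ by (intro extensionalityI[of _ "carrier V'"]) (auto simp: coset_map_def PiE_iff)
  then show ?thesis using \<delta> by blast
qed

theorem isomorphic_H1: "isomorphic_modules K (H1 G V) W"
  unfolding H1_def
proof (rule isomorphic_quotient_moduleI[where f = coset_map])
  show "module K W" by (rule module_Hom_module) (fact V'.group_module_axioms Q.group_module_axioms)+
  show "submodule (coboundaries G V) K Z" by (rule module_H1) (rule group_module_axioms)
qed (use coset_map_closed coset_map_add coset_map_smult coset_map_eq_zero_iff coset_map_surj module_Z in auto)

end

theorem corollary1:
  fixes G :: "('g, 'x) monoid_scheme"
    and K :: "('a, 'y) ring_scheme"
    and V :: "('a, 'v, 'g, 'z) gmodule_scheme"
    and H :: "'g set" and r :: nat
  assumes "group G" and "finite (carrier G)"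
    and "algebraically_closed K" and "ring_char K = r" and "r > 0"
    and "subgroup H G"
    and "core_prime_to r (G\<lparr>carrier := H\<rparr>) = residual_subgroup r (G\<lparr>carrier := H\<rparr>)"
    and "group_module G K V" and "finite_dimensional K V"
    and "fixed_points H V = {\<zero>\<^bsub>V\<^esub>}"
  shows "isomorphic_modules K (H1 G V)
    (Hom_module G K (dual_gmodule G K V)
      (quotient_gmodule (coset_gmodule G K H)
        (fixed_points (carrier G) (coset_gmodule G K H))))"
proof -
  interpret group_module G K V by fact
  interpret H: subgroup H G by fact
  interpret R: group_module "G\<lparr>carrier := H\<rparr>" K V by (rule group_module_subgroup) fact
  have fld: "field K" using assms(3) by (rule algebraically_closed.axioms)
  have finH: "finite (carrier (G\<lparr>carrier := H\<rparr>))"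
    using assms(2) H.subset finite_subset by auto
  \<comment> \<open>Existence of the primitive comes from applying the vanishing result to
    \<open>H\<close> as a group in its own right, uniqueness from the absence of nonzero
    \<open>H\<close>-fixed vectors.\<close>
  have "coset_H1 G K V H"
  proof (intro coset_H1.intro coset_H1_axioms.intro)
    fix \<delta> assume \<delta>: "\<delta> \<in> cocycles G V"
    have res: "restrict \<delta> H \<in> cocycles (G\<lparr>carrier := H\<rparr>) V"
      using \<delta> cocycle_closed cocycle_mult by (auto simp: cocycles_def)
    have "\<exists>v\<in>carrier V. \<forall>h\<in>H. restrict \<delta> H h = act V h v \<ominus>\<^bsub>V\<^esub> v"
      using R.cocycle_coboundary[OF finH fld assms(4,5,7) _ res] assms(10) by simp
    then obtain v where v: "v \<in> carrier V" "\<And>h. h \<in> H \<Longrightarrow> \<delta> h = act V h v \<ominus>\<^bsub>V\<^esub> v"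
      by auto
    have "w = v" if "w \<in> carrier V" "\<And>h. h \<in> H \<Longrightarrow> \<delta> h = act V h w \<ominus>\<^bsub>V\<^esub> w" for w
      using eq_of_coboundary_eq[OF assms(10) H.subset that(1) v(1)] that(2) v(2) by simp
    with v show "\<exists>!v. v \<in> carrier V \<and> (\<forall>h\<in>H. \<delta> h = act V h v \<ominus>\<^bsub>V\<^esub> v)" by blast
  qed fact+
  then show ?thesis by (rule coset_H1.isomorphic_H1)
qed

end
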